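(* Let $\mathcal{X}$ be a countable domain and $\mathcal{H}\subseteq\{0,1\}^{\mathcal{X}}$ a concept class. Then $\mathcal{H}$ is pure differentially private PAC learnable if and only if its fractional clique dimension $\mathtt{CD}^\star(\mathcal{H})$ is finite.
   Context: Datasets, consistency, $\mathcal{H}$-realizability, and the contradiction graph: a dataset of size $m$ is $S=((x_1,y_1),\dots,(x_m,y_m))\in(\mathcal{X}\times\{0,1\})^m$; $h$ is consistent with $S$ if $h(x_i)=y_i$ for all $i$; $S$ is $\mathcal{H}$-realizable if some $h\in\mathcal{H}$ is consistent with it; $G_m(\mathcal{H})$ has as vertices the $\mathcal{H}$-realizable datasets of size $m$, with $S,S'$ adjacent iff there is $x$ with $(x,0)$ appearing in $S$ and $(x,1)$ appearing in $S'$. A fractional clique of a graph $G=(V,E)$ is $\delta:V\to[0,\infty)$ with $\sum_{v\in I}\delta(v)\le1$ for every independent set $I$; its size is $\sum_v\delta(v)$; $\omega^\star_m$ is the supremum of sizes of fractional cliques of $G_m(\mathcal{H})$. The fractional clique dimension is $\mathtt{CD}^\star(\mathcal{H})=\sup\{m:\omega^\star_m=2^m\}\in\mathbb{N}\cup\{\infty\}$. PAC learning: for a distribution $\mathcal{D}$ on $\mathcal{X}\times\{0,1\}$, $L_{\mathcal{D}}(h)=\Pr_{(x,y)\sim\mathcal{D}}[h(x)\ne y]$; $\mathcal{D}$ is realizable if $\inf_{h\in\mathcal{H}}L_{\mathcal{D}}(h)=0$. A (possibly randomized) algorithm $\mathcal{A}$ mapping datasets to hypotheses is an $(m,\alpha,\beta)$-learner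 if for every realizable $\mathcal{D}$, $\Pr_{S\sim\mathcal{D}^m}[L_{\mathcal{D}}(\mathcal{A}(S))>\alpha]<\beta$. $\mathcal{A}$ is $(\epsilon,\delta)$-differentially private if for all datasets $S,S'$ of the same size differing in a single example and every event $E$, $\Pr[\mathcal{A}(S)\in E]\le e^{\epsilon}\Pr[\mathcal{A}(S')\in E]+\delta$. $\mathcal{H}$ is pure DP PAC learnable if there are $\alpha(m),\beta(m)\to0$ and an algorithm that for every $m$ is an $(m,\alpha(m),\beta(m))$-learner and is $(\epsilon,0)$-differentially private for a numerical constant $\epsilon=O(1)$. *)

theory Defs
  imports "HOL-Probability.Probability" "HOL-Library.Extended_Nat"
begin

(* Labels {0,1} are represented by bool: False = 0, True = 1. *)
type_synonym 'x dataset = "('x \<times> bool) list"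

definition consistent :: "('x \<Rightarrow> bool) \<Rightarrow> 'x dataset \<Rightarrow> bool" where
  "consistent h S \<longleftrightarrow> (\<forall>i<length S. h (fst (S ! i)) = snd (S ! i))"

definition realizable_data :: "('x \<Rightarrow> bool) set \<Rightarrow> 'x dataset \<Rightarrow> bool" where
  "realizable_data H S \<longleftrightarrow> (\<exists>h\<in>H. consistent h S)"

definition contra_vertices :: "('x \<Rightarrow> bool) set \<Rightarrow> nat \<Rightarrow> 'x dataset set" where
  "contra_vertices H m = {S. length S = m \<and> realizable_data H S}"

definition contra_adj :: "'x dataset \<Rightarrow> 'x dataset \<Rightarrow> bool" where
  "contra_adj S S' \<longleftrightarrow>
     (\<exists>x. ((x, False) \<in> set S \<and> (x, True) \<in> set S') \<or> ((x, False) \<in> set S' \<and> (x, True) \<in> set S))"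

definition independent_set :: "'v set \<Rightarrow> ('v \<Rightarrow> 'v \<Rightarrow> bool) \<Rightarrow> 'v set \<Rightarrow> bool" where
  "independent_set V E I \<longleftrightarrow> I \<subseteq> V \<and> (\<forall>u\<in>I. \<forall>v\<in>I. \<not> E u v)"

definition fractional_clique :: "'v set \<Rightarrow> ('v \<Rightarrow> 'v \<Rightarrow> bool) \<Rightarrow> ('v \<Rightarrow> real) \<Rightarrow> bool" where
  "fractional_clique V E \<delta> \<longleftrightarrow>
     (\<forall>v\<in>V. 0 \<le> \<delta> v) \<and>
     (\<forall>I. independent_set V E I \<longrightarrow> (\<Sum>\<^sub>\<infinity>v\<in>I. ennreal (\<delta> v)) \<le> 1)"

definition fc_size :: "'v set \<Rightarrow> ('v \<Rightarrow> real) \<Rightarrow> ennreal" where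
  "fc_size V \<delta> = (\<Sum>\<^sub>\<infinity>v\<in>V. ennreal (\<delta> v))"

definition fractional_clique_number :: "'v set \<Rightarrow> ('v \<Rightarrow> 'v \<Rightarrow> bool) \<Rightarrow> ennreal" where
  "fractional_clique_number V E = (SUP \<delta> \<in> {\<delta>. fractional_clique V E \<delta>}. fc_size V \<delta>)"

definition omega_star :: "('x \<Rightarrow> bool) set \<Rightarrow> nat \<Rightarrow> ennreal" where
  "omega_star H m = fractional_clique_number (contra_vertices H m) contra_adj"

definition frac_clique_dim :: "('x \<Rightarrow> bool) set \<Rightarrow> enat" where
  "frac_clique_dim H = Sup {enat m | m. omega_star H m = 2 ^ m}"

definition hyp_space :: "('x \<Rightarrow> bool) measure" where
  "hyp_space = PiM UNIV (\<lambda>_. count_space UNIV)"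

(* Since X is countable, X \<times> {0,1} is countable, so every distribution on it is discrete (a pmf). *)
definition loss :: "('x \<times> bool) pmf \<Rightarrow> ('x \<Rightarrow> bool) \<Rightarrow> real" where
  "loss D h = measure_pmf.prob D {(x, y). h x \<noteq> y}"

(* inf_{h \<in> H} L_D(h) = 0 (losses are nonnegative) *)
definition realizable_dist :: "('x \<Rightarrow> bool) set \<Rightarrow> ('x \<times> bool) pmf \<Rightarrow> bool" where
  "realizable_dist H D \<longleftrightarrow> (\<forall>e>0. \<exists>h\<in>H. loss D h < e)"

definition randomized_alg :: "('x dataset \<Rightarrow> ('x \<Rightarrow> bool) measure) \<Rightarrow> bool" where
  "randomized_alg A \<longleftrightarrow> (\<forall>S. prob_space (A S) \<and> sets (A S) = sets hyp_space)"

definition failure_prob ::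
  "('x dataset \<Rightarrow> ('x \<Rightarrow> bool) measure) \<Rightarrow> ('x \<times> bool) pmf \<Rightarrow> nat \<Rightarrow> real \<Rightarrow> real" where
  "failure_prob A D m \<alpha> =
     measure_pmf.expectation (replicate_pmf m D)
       (\<lambda>S. measure (A S) {h \<in> space hyp_space. loss D h > \<alpha>})"

definition pac_learner ::
  "('x \<Rightarrow> bool) set \<Rightarrow> ('x dataset \<Rightarrow> ('x \<Rightarrow> bool) measure) \<Rightarrow> nat \<Rightarrow> real \<Rightarrow> real \<Rightarrow> bool" where
  "pac_learner H A m \<alpha> \<beta> \<longleftrightarrow> (\<forall>D. realizable_dist H D \<longrightarrow> failure_prob A D m \<alpha> < \<beta>)"

definition neighbouring :: "'x dataset \<Rightarrow> 'x dataset \<Rightarrow> bool" where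
  "neighbouring S S' \<longleftrightarrow> length S = length S' \<and>
     (\<exists>i<length S. \<forall>j<length S. j \<noteq> i \<longrightarrow> S ! j = S' ! j)"

definition differentially_private ::
  "real \<Rightarrow> real \<Rightarrow> ('x dataset \<Rightarrow> ('x \<Rightarrow> bool) measure) \<Rightarrow> bool" where
  "differentially_private \<epsilon> \<delta> A \<longleftrightarrow>
     (\<forall>S S'. neighbouring S S' \<longrightarrow>
        (\<forall>E\<in>sets hyp_space. measure (A S) E \<le> exp \<epsilon> * measure (A S') E + \<delta>))"

definition pure_dp_pac_learnable :: "('x \<Rightarrow> bool) set \<Rightarrow> bool" where
  "pure_dp_pac_learnable H \<longleftrightarrow>
     (\<exists>(\<alpha> :: nat \<Rightarrow> real) (\<beta> :: nat \<Rightarrow> real) A \<epsilon>.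
        \<alpha> \<longlonglongrightarrow> 0 \<and> \<beta> \<longlonglongrightarrow> 0 \<and> randomized_alg A \<and>
        differentially_private \<epsilon> 0 A \<and>
        (\<forall>m. pac_learner H A m (\<alpha> m) (\<beta> m)))"

end

theory Submission
  imports Defs "HOL-Complex_Analysis.Great_Picard" "HOL-Real_Asymp.Real_Asymp"
begin

text \<open>
Both properties are equivalent to the existence of a data-independent distribution \<open>Q\<close> over hypotheses
that is a weak learner: for some \<open>g, c > 0\<close>, every realizable \<open>D\<close> satisfies
\<open>Q {h. loss D h \<le> 1/2 - g} \<ge> c\<close>.

Given a private learner, take \<open>Q = A S\<close> for one fixed dataset \<open>S\<close>; group privacy compares it with all
other outputs. Boosting a weak learner (the majority of \<open>t\<close> independent samples, analysed with the
exponential loss) gives \<open>Q {h. loss D h \<le> th ^ t} \<ge> c ^ t\<close> with \<open>th < 1\<close>. With \<open>D\<close> uniform on a dataset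
of size \<open>n\<close> and \<open>t\<close> of order \<open>sqrt n\<close> this is a fractional colouring of total weight below \<open>2 ^ n\<close>, so
the fractional clique number is below \<open>2 ^ n\<close> for all large \<open>n\<close>. Used as the prior of an exponential
mechanism, the same distribution gives a private learner.

Conversely, if the fractional clique number is below \<open>2 ^ n\<close> for some \<open>n\<close>, linear programming duality
yields \<open>Q\<close> with \<open>Q {h. consistent h S} \<ge> q > 1 / 2 ^ n\<close> for all realizable \<open>S\<close> of size \<open>n\<close>. Averaging over
\<open>S\<close> drawn from \<open>D\<close>, the mean of \<open>(1 - loss D h) ^ n\<close> under \<open>Q\<close> is at least \<open>q\<close>, which forces a weak
learner. As there are infinitely many datasets, duality is obtained by running multiplicative weights
forever on a prior of full support and taking a limit of the empirical measures of the hypotheses played.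
\<close>

section \<open>Hypotheses, losses and realizability\<close>

lemma space_hyp_space [simp]: "space hyp_space = UNIV"
  by (simp add: hyp_space_def space_PiM)

lemma measurable_hyp_component [measurable]: "(\<lambda>h. h x) \<in> hyp_space \<rightarrow>\<^sub>M count_space UNIV"
  unfolding hyp_space_def by measurable

lemma measurable_into_hyp_space:
  assumes "\<And>x. (\<lambda>w. f w x) \<in> M \<rightarrow>\<^sub>M count_space UNIV"
  shows "f \<in> M \<rightarrow>\<^sub>M hyp_space"
  unfolding hyp_space_def by (rule measurable_PiM_single') (use assms in \<open>auto simp: space_PiM\<close>)

lemma consistent_iff: "consistent h S \<longleftrightarrow> (\<forall>z\<in>set S. h (fst z) = snd z)"
  unfolding consistent_def by (metis in_set_conv_nth)

lemma sets_consistent [measurable]: "{h. consistent h S} \<in> sets hyp_space"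
proof -
  have "{h \<in> space hyp_space. \<forall>z\<in>set S. h (fst z) = snd z} \<in> sets hyp_space"
    by measurable
  then show ?thesis by (simp add: consistent_iff)
qed

text \<open>Countability of the sample type turns measurability in \<open>h\<close> for each fixed
  \<open>z\<close> into joint measurability. This is what makes \<open>loss D\<close> and
  \<open>exp_loss l D\<close> measurable.\<close>

lemma borel_measurable_nn_integral_pmf [measurable (raw)]:
  fixes D :: "'a :: countable pmf"
  assumes "\<And>z. (\<lambda>h. f h z) \<in> borel_measurable M"
  shows "(\<lambda>h. \<integral>\<^sup>+z. f h z \<partial>measure_pmf D) \<in> borel_measurable M"
proof -
  have "(\<lambda>(h, z). f h z) \<in> borel_measurable (M \<Otimes>\<^sub>M count_space UNIV)"
    by (rule measurable_compose_countable'[where f="\<lambda>z w. f (fst w) z" and g=snd and I=UNIV, THEN measurable_cong[THEN iffD1, rotated]])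
       (use assms in \<open>auto\<close>)
  then have "(\<lambda>(h, z). f h z) \<in> borel_measurable (M \<Otimes>\<^sub>M measure_pmf D)"
    by (subst measurable_cong_sets[OF sets_pair_measure_cong[OF refl, of _ "count_space UNIV"] refl]) auto
  then show ?thesis
    by (intro measure_pmf.borel_measurable_nn_integral) auto
qed

lemma ennreal_loss: "ennreal (loss D h) = (\<integral>\<^sup>+z. (if h (fst z) \<noteq> snd z then 1 else 0) \<partial>measure_pmf D)"
proof -
  have "ennreal (loss D h) = emeasure (measure_pmf D) {(x, y). h x \<noteq> y}"
    by (simp add: loss_def measure_pmf.emeasure_eq_measure)
  also have "\<dots> = (\<integral>\<^sup>+z. indicator {(x, y). h x \<noteq> y} z \<partial>measure_pmf D)"
    by simp
  also have "\<dots> = (\<integral>\<^sup>+z. (if h (fst z) \<noteq> snd z then 1 else 0) \<partial>measure_pmf D)"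
    by (intro nn_integral_cong) (auto simp: indicator_def)
  finally show ?thesis .
qed

lemma loss_nonneg [simp]: "0 \<le> loss D h" and loss_le_1 [simp]: "loss D h \<le> 1"
  by (simp_all add: loss_def)

lemma borel_measurable_loss [measurable]:
  fixes D :: "('x :: countable \<times> bool) pmf"
  shows "loss D \<in> borel_measurable hyp_space"
proof -
  have "(\<lambda>h. \<integral>\<^sup>+z. (if h (fst z) \<noteq> snd z then 1 else 0) \<partial>measure_pmf D) \<in> borel_measurable hyp_space"
    by (rule borel_measurable_nn_integral_pmf) measurable
  then have "(\<lambda>h. enn2real (ennreal (loss D h))) \<in> borel_measurable hyp_space"
    unfolding ennreal_loss by measurable
  then show ?thesis by simp
qed

text \<open>Fractional cliques are defined through unordered sums; written as integrals against
  counting measure, these sums can be interchanged with other integrals.\<close>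

lemma infsum_ennreal_eq_nn_integral:
  fixes f :: "'a \<Rightarrow> ennreal"
  assumes "countable A"
  shows "infsum f A = (\<integral>\<^sup>+x. f x \<partial>count_space A)"
proof (cases "finite A")
  case True
  then show ?thesis by (simp add: nn_integral_count_space_finite)
next
  case False
  have bij: "bij_betw (from_nat_into A) UNIV A"
    using assms False by (rule bij_betw_from_nat_into)
  have "infsum f A = infsum (\<lambda>n. f (from_nat_into A n)) UNIV"
    by (rule infsum_reindex_bij_betw[OF bij, symmetric])
  also have "\<dots> = (\<Sum>n. f (from_nat_into A n))"
    by (rule sums_unique) (intro has_sum_imp_sums has_sum_infsum nonneg_summable_on_complete, simp)
  also have "\<dots> = (\<integral>\<^sup>+n. f (from_nat_into A n) \<partial>count_space UNIV)"
    by (simp add: nn_integral_count_space_nat)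
  also have "\<dots> = (\<integral>\<^sup>+x. f x \<partial>count_space A)"
    by (rule nn_integral_bij_count_space[OF bij])
  finally show ?thesis .
qed

text \<open>Realizability only depends on the support; hence it survives reweighting of the distribution.\<close>

lemma realizable_dist_iff:
  "realizable_dist H D \<longleftrightarrow>
     (\<forall>K. finite K \<longrightarrow> K \<subseteq> set_pmf D \<longrightarrow> (\<exists>h\<in>H. \<forall>z\<in>K. h (fst z) = snd z))"
proof (intro iffI allI impI)
  fix K assume D: "realizable_dist H D" and K: "finite K" "K \<subseteq> set_pmf D"
  \<comment> \<open>No point of \<open>K\<close> has mass below \<open>e\<close>, so a hypothesis of
    loss less than \<open>e\<close> cannot err on \<open>K\<close>.\<close>
  define e where "e = Min (insert 1 (pmf D ` K))"
  have "e > 0" using K by (auto simp: e_def pmf_positive)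
  then obtain h where h: "h \<in> H" "loss D h < e"
    using D by (auto simp: realizable_dist_def)
  have "h (fst z) = snd z" if "z \<in> K" for z
  proof (rule ccontr)
    assume "h (fst z) \<noteq> snd z"
    then have "measure_pmf.prob D {z} \<le> loss D h"
      unfolding loss_def by (intro measure_pmf.finite_measure_mono) (auto split: prod.splits)
    moreover have "e \<le> pmf D z" using that K by (auto simp: e_def)
    ultimately show False using h by (simp add: measure_pmf_single)
  qed
  with h(1) show "\<exists>h\<in>H. \<forall>z\<in>K. h (fst z) = snd z" by blast
next
  assume *: "\<forall>K. finite K \<longrightarrow> K \<subseteq> set_pmf D \<longrightarrow> (\<exists>h\<in>H. \<forall>z\<in>K. h (fst z) = snd z)"
  show "realizable_dist H D"
    unfolding realizable_dist_def
  proof (intro allI impI)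
    fix e :: real assume "e > 0"
    \<comment> \<open>Finite parts of the countable support carry mass arbitrarily close to 1; a
      hypothesis that fits such a part has loss below \<open>e\<close>.\<close>
    have "\<exists>K. finite K \<and> K \<subseteq> set_pmf D \<and> measure_pmf.prob D K > 1 - e"
    proof -
      have "countable (set_pmf D)" by simp
      then have "infsum (\<lambda>z. ennreal (pmf D z)) (set_pmf D) = 1"
        by (subst infsum_ennreal_eq_nn_integral) (auto simp: nn_integral_pmf measure_pmf.emeasure_eq_measure measure_pmf.prob_eq_1 AE_measure_pmf)
      then have "((\<lambda>z. ennreal (pmf D z)) has_sum 1) (set_pmf D)"
        by (metis has_sum_infsum nonneg_summable_on_complete zero_le)
      then have "((\<lambda>K. ennreal (sum (pmf D) K)) \<longlongrightarrow> ennreal 1) (finite_subsets_at_top (set_pmf D))"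
        by (simp add: has_sum_def sum_ennreal[symmetric] del: sum_ennreal)
      then have "((\<lambda>K. sum (pmf D) K) \<longlongrightarrow> 1) (finite_subsets_at_top (set_pmf D))"
        by (subst (asm) tendsto_ennreal_iff) (auto intro!: always_eventually sum_nonneg)
      then have "\<forall>\<^sub>F K in finite_subsets_at_top (set_pmf D). sum (pmf D) K > 1 - e"
        using \<open>e > 0\<close> by (intro order_tendstoD) auto
      then obtain K where "finite K" "K \<subseteq> set_pmf D" "sum (pmf D) K > 1 - e"
        by (auto simp: eventually_finite_subsets_at_top)
      then show ?thesis by (intro exI[of _ K]) (auto simp: measure_measure_pmf_finite)
    qed
    then obtain K where K: "finite K" "K \<subseteq> set_pmf D" "measure_pmf.prob D K > 1 - e" by auto
    then obtain h where h: "h \<in> H" "\<forall>z\<in>K. h (fst z) = snd z" using * by blast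
    have "loss D h \<le> measure_pmf.prob D (UNIV - K)"
      unfolding loss_def using h by (intro measure_pmf.finite_measure_mono) auto
    also have "\<dots> < e" using K measure_pmf.prob_compl[of K D] by simp
    finally show "\<exists>h\<in>H. loss D h < e" using h by auto
  qed
qed

section \<open>Samples of realizable distributions, weak duality and the trivial bound\<close>

lemma realizable_data_of_support:
  assumes "realizable_dist H D" "S \<in> set_pmf (replicate_pmf n D)"
  shows "S \<in> contra_vertices H n"
proof -
  have "set S \<subseteq> set_pmf D" "length S = n" using assms by (auto simp: set_replicate_pmf)
  then show ?thesis
    using assms(1)[unfolded realizable_dist_iff, rule_format, of "set S"]
    by (auto simp: contra_vertices_def realizable_data_def consistent_iff)
qed

text \<open>Independence of the examples. It is applied to the indicator of consistency and to the
  weights \<open>fit\<close>, both of which are products over the sample.\<close>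

lemma nn_integral_replicate_pmf_prod_list:
  fixes f :: "'a \<Rightarrow> ennreal"
  shows "(\<integral>\<^sup>+S. prod_list (map f S) \<partial>measure_pmf (replicate_pmf m D)) = (\<integral>\<^sup>+z. f z \<partial>measure_pmf D) ^ m"
proof (induction m)
  case (Suc m)
  then show ?case
    by (simp add: nn_integral_cmult nn_integral_multc)
qed simp

text \<open>\<open>Q\<close> is a fractional colouring in which each \<open>h\<close> colours the
  datasets consistent with it. Integrating a fractional clique over the pairs of a dataset and a
  consistent hypothesis gives at least \<open>q\<close> times its size when summed dataset by
  dataset, and at most 1 when integrated hypothesis by hypothesis.\<close>

lemma weak_duality:
  fixes H :: "('x :: countable \<Rightarrow> bool) set"
  assumes Q: "prob_space Q" "sets Q = sets hyp_space" and "q > 0"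
    and cover: "\<And>S. S \<in> contra_vertices H m \<Longrightarrow> q \<le> measure Q {h. consistent h S}"
  shows "omega_star H m \<le> ennreal (1 / q)"
  unfolding omega_star_def fractional_clique_number_def
proof (rule SUP_least, clarify)
  fix d assume d: "fractional_clique (contra_vertices H m) contra_adj d"
  interpret prob_space Q by fact
  let ?V = "contra_vertices H m"
  note [measurable_cong] = Q(2)
  \<comment> \<open>Datasets sharing a consistent hypothesis cannot contradict each other, so each
    colour class is independent.\<close>
  have ind: "(\<Sum>\<^sub>\<infinity>S\<in>{S\<in>?V. consistent h S}. ennreal (d S)) \<le> 1" for h
  proof -
    have "independent_set ?V contra_adj {S\<in>?V. consistent h S}"
      unfolding independent_set_def contra_adj_def consistent_iff by fastforce
    then show ?thesis using d by (auto simp: fractional_clique_def)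
  qed
  have "fc_size ?V d * ennreal q = (\<integral>\<^sup>+S. ennreal (d S) * ennreal q \<partial>count_space ?V)"
    by (simp add: fc_size_def infsum_ennreal_eq_nn_integral nn_integral_multc)
  also have "\<dots> \<le> (\<integral>\<^sup>+S. ennreal (d S) * emeasure Q {h. consistent h S} \<partial>count_space ?V)"
    using cover by (intro nn_integral_mono mult_left_mono) (auto simp: emeasure_eq_measure)
  also have "\<dots> = (\<integral>\<^sup>+S. (\<integral>\<^sup>+h. ennreal (d S) * indicator {h. consistent h S} h \<partial>Q) \<partial>count_space ?V)"
    by (intro nn_integral_cong) (simp add: nn_integral_cmult)
  also have "\<dots> = (\<integral>\<^sup>+h. (\<integral>\<^sup>+S. ennreal (d S) * indicator {h. consistent h S} h \<partial>count_space ?V) \<partial>Q)"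
    by (rule nn_integral_count_space_nn_integral[symmetric]) auto
  also have "\<dots> \<le> (\<integral>\<^sup>+h. 1 \<partial>Q)"
  proof (rule nn_integral_mono)
    fix h
    have "(\<integral>\<^sup>+S. ennreal (d S) * indicator {h. consistent h S} h \<partial>count_space ?V)
        = (\<integral>\<^sup>+S. ennreal (d S) \<partial>count_space {S\<in>?V. consistent h S})"
      by (subst (1 2) nn_integral_count_space_indicator)
         (auto intro!: nn_integral_cong simp: indicator_def)
    also have "\<dots> \<le> 1" using ind[of h] by (simp add: infsum_ennreal_eq_nn_integral)
    finally show "(\<integral>\<^sup>+S. ennreal (d S) * indicator {h. consistent h S} h \<partial>count_space ?V) \<le> 1" .
  qed
  also have "\<dots> = 1" by (simp add: emeasure_space_1)
  finally have le: "fc_size ?V d * ennreal q \<le> 1" .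
  have "fc_size ?V d = fc_size ?V d * (ennreal q * ennreal (1 / q))"
    using \<open>q > 0\<close> by (simp add: ennreal_mult[symmetric])
  also have "\<dots> \<le> 1 * ennreal (1 / q)"
    unfolding mult.assoc[symmetric] by (intro mult_right_mono le) auto
  finally show "fc_size ?V d \<le> ennreal (1 / q)" by simp
qed

text \<open>Labelling every point by an independent fair coin fits any realizable dataset of size
  \<open>m\<close> with probability at least \<open>1 / 2 ^ m\<close>; weak duality turns this into
  the bound.\<close>

lemma omega_star_le_power:
  fixes H :: "('x :: countable \<Rightarrow> bool) set"
  shows "omega_star H m \<le> 2 ^ m"
proof -
  let ?M = "\<lambda>_::'x. measure_pmf (pmf_of_set (UNIV :: bool set))"
  define Q where "Q = PiM UNIV ?M"
  interpret product_prob_space ?M UNIV by unfold_locales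
  have sets: "sets Q = sets hyp_space"
    unfolding Q_def hyp_space_def by (intro sets_PiM_cong) auto
  have "prob_space Q" unfolding Q_def by (rule prob_space_PiM) (rule prob_space_measure_pmf)
  moreover have "(1 / 2) ^ m \<le> measure Q {h. consistent h S}" if S: "S \<in> contra_vertices H m" for S
  proof -
    obtain g where g: "consistent g S" and len: "length S = m"
      using S by (auto simp: contra_vertices_def realizable_data_def)
    let ?J = "fst ` set S"
    have "{h. consistent h S} = {h \<in> space Q. \<forall>x\<in>?J. h x \<in> {g x}}"
      using g by (auto simp: consistent_iff Q_def space_PiM)
    then have "emeasure Q {h. consistent h S} = (\<Prod>x\<in>?J. emeasure (measure_pmf (pmf_of_set UNIV)) {g x})"
      unfolding Q_def by (simp only:) (rule emeasure_PiM_Collect, auto)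
    also have "(\<lambda>x. emeasure (measure_pmf (pmf_of_set UNIV)) {g x}) = (\<lambda>_. ennreal (1 / 2))"
      by (simp add: emeasure_pmf_single pmf_of_set)
    also have "(\<Prod>x\<in>?J. ennreal (1 / 2)) = ennreal ((1 / 2) ^ card ?J)"
      by (simp only: prod_constant) (rule ennreal_power, simp)
    finally have "measure Q {h. consistent h S} = (1 / 2) ^ card ?J"
      by (simp add: measure_def)
    \<comment> \<open>Only distinct points cost a coin flip, so repeated examples make consistency
      more likely.\<close>
    moreover have "card ?J \<le> m" using card_image_le[of "set S" fst] card_length[of S] len by simp
    ultimately show ?thesis by (simp add: power_decreasing)
  qed
  ultimately have "omega_star H m \<le> ennreal (1 / (1 / 2) ^ m)"
    by (intro weak_duality[OF _ sets]) auto
  also have "\<dots> = 2 ^ m" by (simp add: power_one_over ennreal_power[symmetric])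
  finally show ?thesis .
qed

section \<open>Boosting\<close>

text \<open>\<open>Q\<close> is chosen before \<open>D\<close>. The same notion serves before
  boosting, with \<open>a\<close> below 1/2, and after it, with \<open>a = th ^ t\<close>.\<close>

definition weak_learner :: "('x \<Rightarrow> bool) set \<Rightarrow> ('x \<Rightarrow> bool) measure \<Rightarrow> real \<Rightarrow> real \<Rightarrow> bool" where
  "weak_learner H Q a c \<longleftrightarrow> prob_space Q \<and> sets Q = sets hyp_space \<and>
     (\<forall>D. realizable_dist H D \<longrightarrow> c \<le> measure Q {h. loss D h \<le> a})"

text \<open>\<open>D'\<close> has density \<open>w / s\<close> with respect to \<open>D\<close>.
  Strict positivity of \<open>w\<close> keeps the support, and with it realizability.\<close>

lemma reweight_pmf:
  fixes w :: "'a \<Rightarrow> real"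
  assumes w: "\<And>z. 0 < w z" and int: "(\<integral>\<^sup>+z. ennreal (w z) \<partial>measure_pmf D) = ennreal s" and "0 < s"
  obtains D' where "set_pmf D' = set_pmf D"
    and "\<And>f :: 'a \<Rightarrow> ennreal. (\<integral>\<^sup>+z. ennreal (w z) * f z \<partial>measure_pmf D) = ennreal s * (\<integral>\<^sup>+z. f z \<partial>measure_pmf D')"
proof
  define g where "g z = pmf D z * w z / s" for z
  define D' where "D' = embed_pmf g"
  have g_nonneg: "0 \<le> g z" for z
    unfolding g_def using w[of z] \<open>0 < s\<close> by simp
  have g_eq: "ennreal s * ennreal (g z) = ennreal (pmf D z) * ennreal (w z)" for z
    unfolding g_def using w[of z] \<open>0 < s\<close> by (simp add: ennreal_mult[symmetric])
  have "ennreal s * (\<integral>\<^sup>+z. ennreal (g z) \<partial>count_space UNIV) = ennreal s"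
    using int by (simp add: nn_integral_cmult[symmetric] g_eq nn_integral_measure_pmf)
  then have "(\<integral>\<^sup>+z. ennreal (g z) \<partial>count_space UNIV) = 1"
    using \<open>0 < s\<close> ennreal_mult_cancel_left[of "ennreal s" _ 1] by auto
  then have pmf_D': "pmf D' z = g z" for z
    unfolding D'_def using g_nonneg by (intro pmf_embed_pmf) auto
  show "set_pmf D' = set_pmf D"
    unfolding set_eq_iff set_pmf_iff pmf_D' g_def using w \<open>0 < s\<close> by (auto simp: less_imp_neq[THEN not_sym])
  fix f :: "'a \<Rightarrow> ennreal"
  have "ennreal s * (\<integral>\<^sup>+z. f z \<partial>measure_pmf D') = (\<integral>\<^sup>+z. ennreal s * ennreal (g z) * f z \<partial>count_space UNIV)"
    by (simp add: nn_integral_measure_pmf pmf_D' nn_integral_cmult[symmetric] mult.assoc)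
  also have "\<dots> = (\<integral>\<^sup>+z. ennreal (w z) * f z \<partial>measure_pmf D)"
    by (simp add: g_eq nn_integral_measure_pmf mult.assoc)
  finally show "(\<integral>\<^sup>+z. ennreal (w z) * f z \<partial>measure_pmf D) = ennreal s * (\<integral>\<^sup>+z. f z \<partial>measure_pmf D')" ..
qed

text \<open>\<open>score_dist Q t\<close> is the law of the sum of \<open>t\<close> independent \<open>\<plusminus>1\<close>-valued votes; the majority hypothesis is the sign
of the score.\<close>

definition score_space :: "('x \<Rightarrow> real) measure" where
  "score_space = PiM UNIV (\<lambda>_. borel)"

definition add_vote :: "('x \<Rightarrow> real) \<Rightarrow> ('x \<Rightarrow> bool) \<Rightarrow> 'x \<Rightarrow> real" where
  "add_vote F h x = F x + (if h x then 1 else - 1)"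

primrec score_dist :: "('x \<Rightarrow> bool) measure \<Rightarrow> nat \<Rightarrow> ('x \<Rightarrow> real) measure" where
  "score_dist Q 0 = return score_space (\<lambda>_. 0)"
| "score_dist Q (Suc t) = distr (score_dist Q t \<Otimes>\<^sub>M Q) score_space (\<lambda>(F, h). add_vote F h)"

text \<open>The exponential loss of AdaBoost: the exponent is \<open>- l\<close> times the margin,
  that is, the score multiplied by the label read as 1 or -1.\<close>

definition exp_loss :: "real \<Rightarrow> ('x \<times> bool) pmf \<Rightarrow> ('x \<Rightarrow> real) \<Rightarrow> ennreal" where
  "exp_loss l D F = (\<integral>\<^sup>+z. ennreal (exp (l * (if snd z then - F (fst z) else F (fst z)))) \<partial>measure_pmf D)"

lemma space_score_space [simp]: "space score_space = UNIV"
  by (simp add: score_space_def space_PiM)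

lemma measurable_score_component [measurable]: "(\<lambda>F. F x) \<in> borel_measurable score_space"
  unfolding score_space_def by measurable

lemma sets_score_dist [measurable_cong, simp]: "sets (score_dist Q t) = sets score_space"
  by (cases t) auto

lemma space_score_dist [simp]: "space (score_dist Q t) = UNIV"
  using sets_eq_imp_space_eq[OF sets_score_dist] by simp

lemma measurable_add_vote [measurable]:
  "(\<lambda>(F, h). add_vote F h) \<in> score_space \<Otimes>\<^sub>M hyp_space \<rightarrow>\<^sub>M score_space"
proof -
  have "(\<lambda>w. add_vote (fst w) (snd w) x) \<in> borel_measurable (score_space \<Otimes>\<^sub>M hyp_space)" for x
    unfolding add_vote_def by measurable
  then show ?thesis
    unfolding case_prod_beta by (subst (2) score_space_def, intro measurable_PiM_single') auto
qed

lemma measurable_exp_loss [measurable]: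
  fixes D :: "('x :: countable \<times> bool) pmf"
  shows "exp_loss l D \<in> borel_measurable score_space"
  unfolding exp_loss_def by (rule borel_measurable_nn_integral_pmf) measurable

lemma prob_space_score_dist:
  assumes Q: "prob_space Q" and sets_Q: "sets Q = sets hyp_space"
  shows "prob_space (score_dist Q t)"
proof (induction t)
  case (Suc t)
  interpret Q: prob_space Q by fact
  interpret t: prob_space "score_dist Q t" by fact
  interpret pair_prob_space "score_dist Q t" Q ..
  note [measurable_cong] = sets_Q
  show ?case by (simp, intro prob_space_distr) measurable
qed (auto intro: prob_space_return)

lemma one_div_le_self:
  fixes u :: real
  assumes "1 \<le> u"
  shows "1 / u \<le> u"
  using assms by (simp add: field_simps) (metis mult_mono' mult_1 zero_le_one)

text \<open>With \<open>l = ln u\<close>, one more vote multiplies the exponential weight of an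
  example by \<open>u\<close> if the vote is wrong and by \<open>1 / u\<close> if it is right; this
  is the mean factor.\<close>

lemma nn_integral_vote_factor:
  assumes "u \<ge> 1"
  shows "(\<integral>\<^sup>+z. ennreal (if h (fst z) \<noteq> snd z then u else 1 / u) \<partial>measure_pmf D)
    = ennreal (1 / u + (u - 1 / u) * loss D h)"
proof -
  have u: "1 / u \<le> u" using assms by (rule one_div_le_self)
  have "ennreal (if h (fst z) \<noteq> snd z then u else 1 / u)
      = ennreal (1 / u) + ennreal (u - 1 / u) * (if h (fst z) \<noteq> snd z then 1 else 0)" for z
    using assms u by (auto simp flip: ennreal_plus)
  then have "(\<integral>\<^sup>+z. ennreal (if h (fst z) \<noteq> snd z then u else 1 / u) \<partial>measure_pmf D)
      = ennreal (1 / u) + ennreal (u - 1 / u) * ennreal (loss D h)"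
    unfolding ennreal_loss by (simp only:) (simp add: nn_integral_add nn_integral_cmult measure_pmf.emeasure_space_1)
  then show ?thesis
    using assms u by (simp add: ennreal_mult'[symmetric] flip: ennreal_plus)
qed

text \<open>\<open>D'\<close> is \<open>D\<close> reweighted by the current exponential weights, as
  in AdaBoost. The new exponential loss is the old one times the mean vote factor under
  \<open>D'\<close>, which grows with \<open>loss D' h\<close> because
  \<open>1 / u \<le> u\<close>.\<close>

lemma exp_loss_step:
  assumes D: "realizable_dist H D" and u: "u \<ge> 1" and a: "0 \<le> a" and fin: "exp_loss (ln u) D F \<le> ennreal b"
  obtains D' where "realizable_dist H D'"
    and "\<And>h. loss D' h \<le> a \<Longrightarrow>
      exp_loss (ln u) D (add_vote F h) \<le> ennreal (1 / u + (u - 1 / u) * a) * exp_loss (ln u) D F"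
proof -
  let ?l = "ln u"
  define w where "w z = exp (?l * (if snd z then - F (fst z) else F (fst z)))" for z :: "'a \<times> bool"
  have exp_l: "exp ?l = u" using u by simp
  have w_int: "exp_loss ?l D F = (\<integral>\<^sup>+z. ennreal (w z) \<partial>measure_pmf D)"
    by (simp add: exp_loss_def w_def)
  have w_pos: "0 < w z" for z by (simp add: w_def)
  obtain s where s: "exp_loss ?l D F = ennreal s" "0 \<le> s"
    using fin by (cases "exp_loss ?l D F") (auto simp: top_unique)
  \<comment> \<open>The normalizing constant must be positive; it is finite by
    \<open>fin\<close>.\<close>
  have "s \<noteq> 0"
  proof
    assume "s = 0"
    then have "AE z in measure_pmf D. ennreal (w z) = 0"
      using s w_int by (simp flip: nn_integral_0_iff_AE)
    moreover obtain z where "z \<in> set_pmf D" using set_pmf_not_empty[of D] by blast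
    ultimately have "ennreal (w z) = 0" by (simp add: AE_measure_pmf_iff)
    then show False using w_pos[of z] by (simp add: ennreal_eq_0_iff)
  qed
  with s have "0 < s" by simp
  obtain D' where supp: "set_pmf D' = set_pmf D"
    and D': "\<And>f :: 'a \<times> bool \<Rightarrow> ennreal. (\<integral>\<^sup>+z. ennreal (w z) * f z \<partial>measure_pmf D) = ennreal s * (\<integral>\<^sup>+z. f z \<partial>measure_pmf D')"
    using reweight_pmf[of w D s] w_pos s(1) w_int \<open>0 < s\<close> by metis
  show thesis
  proof
    show "realizable_dist H D'" using D supp by (simp add: realizable_dist_iff)
    fix h assume h: "loss D' h \<le> a"
    have factor: "ennreal (exp (?l * (if snd z then - add_vote F h (fst z) else add_vote F h (fst z))))
        = ennreal (w z) * ennreal (if h (fst z) \<noteq> snd z then u else 1 / u)" for z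
      using exp_l u w_pos[of z]
      by (auto simp: w_def add_vote_def ennreal_mult'[symmetric] algebra_simps exp_add exp_diff exp_minus field_simps)
    have "exp_loss ?l D (add_vote F h) = ennreal s * ennreal (1 / u + (u - 1 / u) * loss D' h)"
      unfolding exp_loss_def factor D' nn_integral_vote_factor[OF u] ..
    also have "\<dots> \<le> ennreal s * ennreal (1 / u + (u - 1 / u) * a)"
    proof -
      have "1 / u \<le> u" using u by (rule one_div_le_self)
      then show ?thesis using h by (intro mult_left_mono ennreal_leI add_left_mono) auto
    qed
    finally show "exp_loss ?l D (add_vote F h) \<le> ennreal (1 / u + (u - 1 / u) * a) * exp_loss ?l D F"
      by (simp add: s mult.commute)
  qed
qed

text \<open>The votes are drawn from \<open>Q\<close> without looking at \<open>D\<close>, but with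
  probability at least \<open>c\<close> per round the next vote happens to be one that a booster for
  \<open>D\<close> would accept. Independence multiplies these probabilities.\<close>

lemma score_dist_exp_loss:
  fixes H :: "('x :: countable \<Rightarrow> bool) set"
  assumes Q: "weak_learner H Q a c" and c: "0 \<le> c" and a: "0 \<le> a" and u: "u \<ge> 1" and D: "realizable_dist H D"
    and th: "th = 1 / u + (u - 1 / u) * a"
  shows "ennreal (c ^ t) \<le> emeasure (score_dist Q t) {F. exp_loss (ln u) D F \<le> ennreal (th ^ t)}"
proof (induction t)
  case 0
  have "exp_loss (ln u) D (\<lambda>_. 0) = 1" by (simp add: exp_loss_def measure_pmf.emeasure_space_1 if_distrib cong: if_cong)
  moreover have "{F \<in> space score_space. exp_loss (ln u) D F \<le> 1} \<in> sets score_space" by measurable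
  ultimately show ?case by (simp add: emeasure_return)
next
  case (Suc t)
  have prob: "prob_space Q" and sets_Q: "sets Q = sets hyp_space"
    using Q by (auto simp: weak_learner_def)
  note [measurable_cong] = sets_Q
  interpret Q: prob_space Q by fact
  let ?E = "\<lambda>t. {F. exp_loss (ln u) D F \<le> ennreal (th ^ t)}"
  have "1 / u \<le> u" using u by (rule one_div_le_self)
  then have "0 \<le> th" using u a th by simp
  have space_Q: "space Q = UNIV" using sets_eq_imp_space_eq[OF sets_Q] by simp
  have E: "?E t \<in> sets score_space" for t
  proof -
    have "{F \<in> space score_space. exp_loss (ln u) D F \<le> ennreal (th ^ t)} \<in> sets score_space" by measurable
    then show ?thesis by simp
  qed
  \<comment> \<open>The reweighted distribution depends on \<open>F\<close>, but only its existence
    for each fixed \<open>F\<close> matters here, so no measurable choice of it is involved.\<close>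
  have step: "ennreal c * indicator (?E t) F \<le> emeasure Q {h. add_vote F h \<in> ?E (Suc t)}" for F
  proof (cases "F \<in> ?E t")
    case True
    then obtain D' where D': "realizable_dist H D'" and
      dec: "\<And>h. loss D' h \<le> a \<Longrightarrow> exp_loss (ln u) D (add_vote F h) \<le> ennreal th * exp_loss (ln u) D F"
      using exp_loss_step[OF D u a, of F "th ^ t"] th by auto
    have "ennreal c \<le> emeasure Q {h. loss D' h \<le> a}"
      using Q D' by (simp add: weak_learner_def Q.emeasure_eq_measure)
    also have "\<dots> \<le> emeasure Q {h. add_vote F h \<in> ?E (Suc t)}"
    proof (rule emeasure_mono)
      show "{h. loss D' h \<le> a} \<subseteq> {h. add_vote F h \<in> ?E (Suc t)}"
      proof clarify
        fix h assume "loss D' h \<le> a"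
        then have "exp_loss (ln u) D (add_vote F h) \<le> ennreal th * exp_loss (ln u) D F" by (rule dec)
        also have "\<dots> \<le> ennreal th * ennreal (th ^ t)" using True by (intro mult_left_mono) auto
        finally show "exp_loss (ln u) D (add_vote F h) \<le> ennreal (th ^ Suc t)"
          using \<open>0 \<le> th\<close> by (simp add: ennreal_mult)
      qed
      have "(\<lambda>h. (F, h)) \<in> Q \<rightarrow>\<^sub>M score_space \<Otimes>\<^sub>M hyp_space"
        by (intro measurable_Pair measurable_ident_sets[OF sets_Q]) auto
      then have "(\<lambda>h. add_vote F h) \<in> Q \<rightarrow>\<^sub>M score_space"
        using measurable_compose[OF _ measurable_add_vote, of "\<lambda>h. (F, h)" Q] by simp
      from measurable_sets[OF this E[of "Suc t"]] show "{h. add_vote F h \<in> ?E (Suc t)} \<in> sets Q"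
        by (simp add: vimage_def space_Q)
    qed
    finally show ?thesis using True by simp
  qed simp
  have "ennreal (c ^ Suc t) \<le> ennreal c * emeasure (score_dist Q t) (?E t)"
    using Suc c by (simp add: ennreal_mult mult_left_mono)
  also have "\<dots> = (\<integral>\<^sup>+F. ennreal c * indicator (?E t) F \<partial>score_dist Q t)"
    using E by (simp add: nn_integral_cmult)
  also have "\<dots> \<le> (\<integral>\<^sup>+F. emeasure Q {h. add_vote F h \<in> ?E (Suc t)} \<partial>score_dist Q t)"
    by (intro nn_integral_mono step)
  also have "\<dots> = emeasure (score_dist Q (Suc t)) (?E (Suc t))"
  proof -
    let ?A = "(\<lambda>(F, h). add_vote F h) -` ?E (Suc t) \<inter> space (score_dist Q t \<Otimes>\<^sub>M Q)"
    have "?A \<in> sets (score_dist Q t \<Otimes>\<^sub>M Q)"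
      by (rule measurable_sets[OF _ E]) measurable
    then have "emeasure (score_dist Q t \<Otimes>\<^sub>M Q) ?A = (\<integral>\<^sup>+F. emeasure Q (Pair F -` ?A) \<partial>score_dist Q t)"
      by (rule Q.emeasure_pair_measure_alt)
    moreover have "Pair F -` ?A = {h. add_vote F h \<in> ?E (Suc t)}" for F
      by (auto simp: space_pair_measure space_Q)
    moreover have "emeasure (score_dist Q (Suc t)) (?E (Suc t)) = emeasure (score_dist Q t \<Otimes>\<^sub>M Q) ?A"
      unfolding score_dist.simps by (rule emeasure_distr[OF _ E]) measurable
    ultimately show ?thesis by simp
  qed
  finally show ?case .
qed

text \<open>Where the vote errs the exponent is nonnegative, so the exponential is at least 1. A
  score of 0 is read as label \<open>False\<close>, and the exponential is then exactly 1.\<close>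

lemma loss_vote_le_exp_loss:
  assumes "0 \<le> l"
  shows "ennreal (loss D (\<lambda>x. F x > 0)) \<le> exp_loss l D F"
  unfolding ennreal_loss exp_loss_def
proof (rule nn_integral_mono)
  fix z :: "'a \<times> bool"
  show "(if (F (fst z) > 0) \<noteq> snd z then 1 else 0)
      \<le> ennreal (exp (l * (if snd z then - F (fst z) else F (fst z))))"
    using assms by (auto simp: mult_nonneg_nonpos)
qed

lemma boosting:
  fixes H :: "('x :: countable \<Rightarrow> bool) set"
  assumes Q: "weak_learner H Q (1 / 2 - g) c" and c: "0 < c" and g: "0 < g" "g \<le> 1 / 2"
  obtains th where "0 < th" "th < 1" "\<And>t. \<exists>Q. weak_learner H Q (th ^ t) (c ^ t)"
proof
  \<comment> \<open>This choice gives \<open>u * th = u - (3 / 2 * g ^ 2 + g ^ 3)\<close>, hence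
    \<open>th < 1\<close>.\<close>
  define u where "u = 1 + g"
  define th where "th = 1 / u + (u - 1 / u) * (1 / 2 - g)"
  have prob: "prob_space Q" and sets_Q: "sets Q = sets hyp_space"
    using Q by (auto simp: weak_learner_def)
  have u: "u \<ge> 1" using g by (simp add: u_def)
  have "u * (1 / u) = 1" using u by simp
  moreover have "u * th = u * (1 / u) + (u * u - u * (1 / u)) * (1 / 2 - g)"
    unfolding th_def by (simp only: distrib_left right_diff_distrib left_diff_distrib mult.assoc)
  ultimately have "u * th = u * 1 - (3 / 2 * g ^ 2 + g ^ 3)"
    by (simp add: u_def algebra_simps power2_eq_square power3_eq_cube)
  moreover have "0 < 3 / 2 * g ^ 2 + g ^ 3"
    using g by (intro add_pos_pos) auto
  ultimately have "u * th < u * 1" by linarith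
  then show "th < 1" using u by (subst (asm) mult_less_cancel_left_pos) auto
  have "1 / u \<le> u" using u by (rule one_div_le_self)
  then have "0 \<le> (u - 1 / u) * (1 / 2 - g)" using g by simp
  moreover have "0 < 1 / u" using u by simp
  ultimately show "0 < th" unfolding th_def by (rule add_pos_nonneg[rotated])
  fix t
  define Q' where "Q' = distr (score_dist Q t) hyp_space (\<lambda>F x. F x > 0)"
  have meas: "(\<lambda>F x. F x > 0) \<in> score_dist Q t \<rightarrow>\<^sub>M hyp_space"
    by (rule measurable_into_hyp_space) measurable
  interpret S: prob_space "score_dist Q t" by (rule prob_space_score_dist) fact+
  have "c ^ t \<le> measure Q' {h. loss D h \<le> th ^ t}" if D: "realizable_dist H D" for D
  proof -
    have "ennreal (c ^ t) \<le> emeasure (score_dist Q t) {F. exp_loss (ln u) D F \<le> ennreal (th ^ t)}"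
      by (rule score_dist_exp_loss[OF Q _ _ u D th_def]) (use c g in auto)
    also have "\<dots> \<le> emeasure (score_dist Q t) {F. loss D (\<lambda>x. F x > 0) \<le> th ^ t}"
    proof (rule emeasure_mono)
      show "{F. exp_loss (ln u) D F \<le> ennreal (th ^ t)} \<subseteq> {F. loss D (\<lambda>x. F x > 0) \<le> th ^ t}"
        using loss_vote_le_exp_loss[of "ln u" D] u \<open>0 < th\<close>
        by (auto dest!: order_trans[OF loss_vote_le_exp_loss, rotated])
      have "{F \<in> space (score_dist Q t). loss D (\<lambda>x. F x > 0) \<le> th ^ t} \<in> sets (score_dist Q t)"
        using measurable_compose[OF meas borel_measurable_loss] by measurable
      then show "{F. loss D (\<lambda>x. F x > 0) \<le> th ^ t} \<in> sets (score_dist Q t)" by simp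
    qed
    also have "\<dots> = emeasure Q' {h. loss D h \<le> th ^ t}"
    proof -
      have "{h \<in> space hyp_space. loss D h \<le> th ^ t} \<in> sets hyp_space" by measurable
      then show ?thesis unfolding Q'_def by (subst emeasure_distr[OF meas]) (auto simp: vimage_def)
    qed
    finally show ?thesis
      using finite_measure.emeasure_eq_measure[OF prob_space.finite_measure[OF S.prob_space_distr[OF meas]]]
      by (simp add: Q'_def)
  qed
  then have "weak_learner H Q' (th ^ t) (c ^ t)"
    unfolding weak_learner_def Q'_def using S.prob_space_distr[OF meas] by simp
  then show "\<exists>Q. weak_learner H Q (th ^ t) (c ^ t)" ..
qed

section \<open>From private learners to fractional colourings\<close>

text \<open>Hybrid argument: the entries of \<open>S\<close> are replaced by those of
  \<open>S'\<close> one position at a time. The absolute value covers a privacy parameter of either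
  sign.\<close>

lemma group_privacy:
  assumes dp: "differentially_private e 0 A" and E: "E \<in> sets hyp_space" and len: "length S = length S'"
  shows "measure (A S) E \<le> exp \<bar>e\<bar> ^ length S * measure (A S') E"
proof -
  have "measure (A S) E \<le> exp \<bar>e\<bar> ^ k * measure (A (take k S' @ drop k S)) E" if "k \<le> length S" for k
    using that
  proof (induction k)
    case (Suc k)
    let ?U = "take k S' @ drop k S" and ?V = "take (Suc k) S' @ drop (Suc k) S"
    have "?U ! j = ?V ! j" if "j < length S" "j \<noteq> k" for j
      using that Suc.prems len by (auto simp: nth_append min_def not_less)
    then have "neighbouring ?U ?V"
      using Suc.prems len by (auto simp: neighbouring_def min_def intro!: exI[of _ k])
    then have "measure (A ?U) E \<le> exp e * measure (A ?V) E"
      using dp E by (auto simp: differentially_private_def)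
    also have "\<dots> \<le> exp \<bar>e\<bar> * measure (A ?V) E"
      by (intro mult_right_mono) auto
    finally have "exp \<bar>e\<bar> ^ k * measure (A ?U) E \<le> exp \<bar>e\<bar> ^ k * (exp \<bar>e\<bar> * measure (A ?V) E)"
      by (intro mult_left_mono) auto
    with Suc.IH Suc.prems have "measure (A S) E \<le> exp \<bar>e\<bar> ^ k * (exp \<bar>e\<bar> * measure (A ?V) E)"
      by linarith
    then show ?case by (simp only: power_Suc2 mult.assoc)
  qed simp
  from this[of "length S"] show ?thesis using len by simp
qed

lemma weak_learner_of_private_learner:
  fixes H :: "('x :: countable \<Rightarrow> bool) set"
  assumes A: "randomized_alg A" and dp: "differentially_private e 0 A" and pac: "pac_learner H A m a (1 / 2)"
  obtains Q c where "0 < c" "weak_learner H Q a c"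
proof
  \<comment> \<open>Only the length of the reference dataset matters, since group privacy compares
    it with every sample of size \<open>m\<close>.\<close>
  define S0 :: "'x dataset" where "S0 = replicate m undefined"
  have prob: "prob_space (A S)" and sets_A: "sets (A S) = sets hyp_space" for S
    using A by (auto simp: randomized_alg_def)
  have space_A: "space (A S) = UNIV" for S
    using sets_eq_imp_space_eq[OF sets_A] by simp
  let ?K = "exp \<bar>e\<bar> ^ m"
  show "0 < 1 / (2 * ?K)" by simp
  have "1 / (2 * ?K) \<le> measure (A S0) {h. loss D h \<le> a}" if D: "realizable_dist H D" for D
  proof -
    let ?G = "{h. loss D h \<le> a}" and ?B = "{h. loss D h > a}"
    have "{h \<in> space hyp_space. loss D h \<le> a} \<in> sets hyp_space" by measurable
    then have G: "?G \<in> sets hyp_space" by simp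
    have fail: "measure (A S) ?B = 1 - measure (A S) ?G" for S
    proof -
      have "?B = space (A S) - ?G" by (auto simp: space_A)
      then show ?thesis using prob_space.prob_compl[OF prob, of ?G S] G sets_A by simp
    qed
    \<comment> \<open>If good hypotheses were too rare in \<open>A S0\<close>, they would be rare in
      \<open>A S\<close> for every sample \<open>S\<close>, and the learner would fail too
      often.\<close>
    have "1 - ?K * measure (A S0) ?G \<le> failure_prob A D m a"
    proof -
      have "1 - ?K * measure (A S0) ?G = (\<integral>S. 1 - ?K * measure (A S0) ?G \<partial>measure_pmf (replicate_pmf m D))"
        by simp
      also have "\<dots> \<le> (\<integral>S. measure (A S) ?B \<partial>measure_pmf (replicate_pmf m D))"
      proof (rule integral_mono_AE)
        show "integrable (measure_pmf (replicate_pmf m D)) (\<lambda>S. measure (A S) ?B)"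
          by (rule measure_pmf.integrable_const_bound[of _ 1])
             (auto simp: prob_space.prob_le_1[OF prob])
        show "AE S in measure_pmf (replicate_pmf m D). 1 - ?K * measure (A S0) ?G \<le> measure (A S) ?B"
          unfolding AE_measure_pmf_iff
        proof
          fix S assume "S \<in> set_pmf (replicate_pmf m D)"
          then have "length S = m" by (auto simp: set_replicate_pmf)
          then show "1 - ?K * measure (A S0) ?G \<le> measure (A S) ?B"
            using group_privacy[OF dp G, of S S0] by (simp add: fail S0_def)
        qed
      qed simp
      finally show ?thesis by (simp add: failure_prob_def)
    qed
    also have "\<dots> < 1 / 2" using pac D by (auto simp: pac_learner_def)
    finally have "1 / 2 < ?K * measure (A S0) ?G" by simp
    then show ?thesis by (simp add: field_simps)
  qed
  then show "weak_learner H (A S0) a (1 / (2 * ?K))"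
    using prob sets_A by (auto simp: weak_learner_def)
qed

section \<open>Bounding the fractional clique number by a learner\<close>

lemma weak_learner_mono:
  fixes H :: "('x :: countable \<Rightarrow> bool) set"
  assumes Q: "weak_learner H Q a c" and "a \<le> b"
  shows "weak_learner H Q b c"
proof -
  have prob: "prob_space Q" and sets_Q: "sets Q = sets hyp_space"
    using Q by (auto simp: weak_learner_def)
  interpret prob_space Q by fact
  have "measure Q {h. loss D h \<le> a} \<le> measure Q {h. loss D h \<le> b}" for D
  proof (rule finite_measure_mono)
    have "{h \<in> space hyp_space. loss D h \<le> b} \<in> sets hyp_space" by measurable
    then show "{h. loss D h \<le> b} \<in> sets Q" by (simp add: sets_Q)
  qed (use \<open>a \<le> b\<close> in auto)
  then show ?thesis using Q by (auto simp: weak_learner_def intro: order_trans)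
qed

text \<open>For the uniform distribution on the entries of a dataset, a single error costs at least
  \<open>1 / n\<close>, which exceeds \<open>a\<close>. So every hypothesis of loss at most
  \<open>a\<close> is consistent, and weak duality applies.\<close>

lemma omega_star_le_of_weak_learner:
  fixes H :: "('x :: countable \<Rightarrow> bool) set"
  assumes Q: "weak_learner H Q a c" and "0 < c" and a: "real n * a < 1"
  shows "omega_star H n \<le> ennreal (1 / c)"
proof -
  have prob: "prob_space Q" and sets_Q: "sets Q = sets hyp_space"
    using Q by (auto simp: weak_learner_def)
  interpret prob_space Q by fact
  have "c \<le> measure Q {h. consistent h S}" if S: "S \<in> contra_vertices H n" for S
  \<comment> \<open>The empty dataset carries no uniform distribution. There every hypothesis is
    consistent, and \<open>c \<le> 1\<close> follows from a one-point realizable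
    distribution.\<close>
  proof (cases "n = 0")
    case True
    have "c \<le> 1"
    proof -
      obtain h where "h \<in> H" using S by (auto simp: contra_vertices_def realizable_data_def)
      then have "realizable_dist H (return_pmf (undefined, h undefined))"
        unfolding realizable_dist_iff by (intro allI impI bexI[of _ h]) auto
      then have "c \<le> measure Q {h'. loss (return_pmf (undefined, h undefined)) h' \<le> a}"
        using Q by (auto simp: weak_learner_def)
      also have "\<dots> \<le> 1" by simp
      finally show ?thesis .
    qed
    moreover have "{h. consistent h S} = space Q"
      using S True sets_eq_imp_space_eq[OF sets_Q] by (auto simp: contra_vertices_def consistent_def)
    ultimately show ?thesis using prob_space by simp
  next
    case False
    \<comment> \<open>Drawing a uniform index gives each occurrence of an example mass
      \<open>1 / n\<close>, repeated or not.\<close>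
    define D where "D = map_pmf ((!) S) (pmf_of_set {..<n})"
    have len: "length S = n" using S by (simp add: contra_vertices_def)
    have ne: "{..<n} \<noteq> {}" "finite {..<n}" using False by auto
    have supp: "set_pmf D = set S"
      using ne len nth_image[of n S] by (simp add: D_def set_pmf_of_set lessThan_atLeast0)
    obtain g where "g \<in> H" "consistent g S"
      using S by (auto simp: contra_vertices_def realizable_data_def)
    then have "realizable_dist H D"
      unfolding realizable_dist_iff supp consistent_iff by (intro allI impI bexI[of _ g]) auto
    then have "c \<le> measure Q {h. loss D h \<le> a}" using Q by (auto simp: weak_learner_def)
    also have "\<dots> \<le> measure Q {h. consistent h S}"
    proof (rule finite_measure_mono)
      show "{h. loss D h \<le> a} \<subseteq> {h. consistent h S}"
      proof clarify
        fix h assume le: "loss D h \<le> a"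
        show "consistent h S" unfolding consistent_def
        proof (intro allI impI, rule ccontr)
          fix i assume i: "i < length S" "h (fst (S ! i)) \<noteq> snd (S ! i)"
          have "1 / real n = measure_pmf.prob (pmf_of_set {..<n}) {i}"
            using ne i len by (simp add: measure_pmf_single)
          also have "\<dots> \<le> measure_pmf.prob (pmf_of_set {..<n}) ((!) S -` {(x, y). h x \<noteq> y})"
            using i by (intro measure_pmf.finite_measure_mono) (auto split: prod.splits)
          also have "\<dots> = loss D h" by (simp add: loss_def D_def)
          finally have "1 / real n \<le> a" using le by simp
          then have "real n * (1 / real n) \<le> real n * a" by (intro mult_left_mono) auto
          then show False using a False by simp
        qed
      qed
    qed (simp add: sets_Q)
    finally show ?thesis .
  qed
  then show ?thesis by (intro weak_duality[OF prob sets_Q \<open>0 < c\<close>])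
qed

text \<open>A supremum of natural numbers in \<open>enat\<close> is finite iff the set is finite,
  and \<open>omega_star_le_power\<close> makes failure of equality a strict inequality.\<close>

lemma frac_clique_dim_finite_iff:
  fixes H :: "('x :: countable \<Rightarrow> bool) set"
  shows "frac_clique_dim H \<noteq> \<infinity> \<longleftrightarrow> (\<forall>\<^sub>F m in sequentially. omega_star H m < 2 ^ m)"
proof -
  let ?M = "{m. omega_star H m = 2 ^ m}"
  have im: "{enat m |m. omega_star H m = 2 ^ m} = enat ` ?M" by auto
  have "frac_clique_dim H \<noteq> \<infinity> \<longleftrightarrow> finite ?M"
  proof (cases "finite ?M \<and> ?M \<noteq> {}")
    case True
    then have "Max (enat ` ?M) \<in> enat ` ?M" by (intro Max_in) auto
    then show ?thesis using True unfolding frac_clique_dim_def im Sup_enat_def by fastforce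
  next
    case False
    have "finite (enat ` ?M) \<longleftrightarrow> finite ?M" by (intro finite_image_iff inj_onI) simp
    with False show ?thesis by (auto simp: frac_clique_dim_def im Sup_enat_def zero_enat_def)
  qed
  also have "\<dots> \<longleftrightarrow> (\<forall>\<^sub>F m in sequentially. omega_star H m \<noteq> 2 ^ m)"
    by (simp add: eventually_cofinite flip: cofinite_eq_sequentially)
  also have "\<dots> \<longleftrightarrow> (\<forall>\<^sub>F m in sequentially. omega_star H m < 2 ^ m)"
    by (intro eventually_cong refl always_eventually allI) (auto simp: less_le omega_star_le_power)
  finally show ?thesis .
qed

lemma frac_clique_dim_finite_of_weak_learner:
  fixes H :: "('x :: countable \<Rightarrow> bool) set"
  assumes Q: "weak_learner H Q (1 / 2 - g) c" and c: "0 < c" and g: "0 < g" "g \<le> 1 / 2"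
  shows "frac_clique_dim H \<noteq> \<infinity>"
proof -
  obtain th where th: "0 < th" "th < 1" and boost: "\<And>t. \<exists>Q. weak_learner H Q (th ^ t) (c ^ t)"
    using boosting[OF assms] by metis
  \<comment> \<open>\<open>d\<close> can be negative: \<open>c\<close> may exceed 1 if no
    distribution is realizable. Hence the absolute values below.\<close>
  define d where "d = ln (1 / c)"
  define l where "l = ln (1 / th)"
  have "0 < l" using th by (simp add: l_def)
  \<comment> \<open>The number of votes must outgrow \<open>ln n\<close>, so that
    \<open>n * th ^ t n < 1\<close>, yet stay of smaller order than \<open>n\<close>, so that
    \<open>(1 / c) ^ t n < 2 ^ n\<close>.\<close>
  define t where "t n = nat \<lfloor>sqrt (real n)\<rfloor>" for n
  have t: "real (t n) \<le> sqrt n" "sqrt n - 1 \<le> real (t n)" for n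
    unfolding t_def by (auto simp: of_nat_nat)
  have "\<forall>\<^sub>F n in sequentially. ln (real n) - l * (sqrt n - 1) < 0"
    using \<open>0 < l\<close> by real_asymp
  moreover have "\<forall>\<^sub>F n in sequentially. \<bar>d\<bar> * sqrt n < real n * ln 2"
    by real_asymp
  ultimately have "\<forall>\<^sub>F n in sequentially. omega_star H n < 2 ^ n"
    using eventually_gt_at_top[of 0]
  proof eventually_elim
    case (elim n)
    obtain Q' where Q': "weak_learner H Q' (th ^ t n) (c ^ t n)" using boost by blast
    have "real n * th ^ t n = exp (ln (real n) - l * real (t n))"
    proof -
      have "exp (l * real (t n)) = (1 / th) ^ t n"
        using th by (simp add: l_def exp_of_nat2_mult)
      then show ?thesis using elim by (simp add: exp_diff power_one_over)
    qed
    also have "\<dots> < exp 0"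
      using elim mult_left_mono[OF t(2)[of n], of l] \<open>0 < l\<close> by (intro exp_less_mono) linarith
    finally have "real n * th ^ t n < 1" by simp
    with Q' have "omega_star H n \<le> ennreal (1 / c ^ t n)"
      using c by (intro omega_star_le_of_weak_learner) auto
    also have "1 / c ^ t n < 2 ^ n"
    proof -
      have "1 / c ^ t n = exp (real (t n) * d)"
        using c by (simp add: d_def exp_of_nat_mult power_one_over)
      also have "real (t n) * d \<le> real (t n) * \<bar>d\<bar>" by (intro mult_left_mono) auto
      also have "\<dots> \<le> sqrt n * \<bar>d\<bar>" using t(1)[of n] by (intro mult_right_mono) auto
      also have "\<dots> < real n * ln 2" using elim by (simp add: mult.commute)
      also have "exp (real n * ln 2) = 2 ^ n" by (simp add: exp_of_nat_mult)
      finally show ?thesis by simp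
    qed
    then have "ennreal (1 / c ^ t n) < 2 ^ n"
      using c by (subst ennreal_numeral[symmetric], subst ennreal_power) (auto intro!: ennreal_lessI)
    finally show ?case .
  qed
  then show ?thesis by (simp only: frac_clique_dim_finite_iff)
qed

lemma frac_clique_dim_finite_of_learnable:
  fixes H :: "('x :: countable \<Rightarrow> bool) set"
  assumes "pure_dp_pac_learnable H"
  shows "frac_clique_dim H \<noteq> \<infinity>"
proof -
  obtain a b :: "nat \<Rightarrow> real" and A e where lim: "a \<longlonglongrightarrow> 0" "b \<longlonglongrightarrow> 0"
    and A: "randomized_alg A" "differentially_private e 0 A" and pac: "\<And>m. pac_learner H A m (a m) (b m)"
    using assms by (auto simp: pure_dp_pac_learnable_def)
  have "\<forall>\<^sub>F m in sequentially. a m < 1 / 4 \<and> b m < 1 / 2"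
    using lim by (intro eventually_conj order_tendstoD) auto
  then obtain m where m: "a m < 1 / 4" "b m < 1 / 2"
    by (auto simp: eventually_sequentially)
  with pac[of m] have "pac_learner H A m (a m) (1 / 2)"
    by (auto simp: pac_learner_def intro: less_trans)
  with A obtain Q c where Q: "0 < c" "weak_learner H Q (a m) c"
    by (rule weak_learner_of_private_learner)
  have "weak_learner H Q (1 / 2 - 1 / 4) c"
    using m by (intro weak_learner_mono[OF Q(2)]) auto
  then show ?thesis
    by (rule frac_clique_dim_finite_of_weak_learner) (use Q in auto)
qed

section \<open>Linear programming duality\<close>

text \<open>Split \<open>[0, 1)\<close> recursively into half-open intervals of length \<open>l p\<close>, in lexicographic order of the words \<open>p\<close>,
and read off the bits of the interval that contains a uniform random point.\<close>

lemma measure_of_prefix_weights: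
  fixes l :: "bool list \<Rightarrow> real"
  assumes l_Nil: "l [] = 1" and l_nonneg: "\<And>p. 0 \<le> l p"
    and l_split: "\<And>p. l p = l (p @ [False]) + l (p @ [True])"
  obtains Q :: "(nat \<Rightarrow> bool) measure" where "prob_space Q" "sets Q = sets hyp_space"
    and "\<And>p. measure Q {h. map h [0..<length p] = p} = l p"
proof -
  \<comment> \<open>The left endpoint is the total weight of the words of the same length that
    precede \<open>p\<close>, grouped by the first position \<open>i\<close> where they have
    \<open>False\<close> and \<open>p\<close> has \<open>True\<close>.\<close>
  define left where "left p = (\<Sum>i<length p. if p ! i then l (take i p @ [False]) else 0)" for p
  define pre where "pre n U = rec_nat [] (\<lambda>_ p. p @ [left p + l (p @ [False]) \<le> U]) n" for n and U :: real
  define h where "h U i = last (pre (Suc i) U)" for U i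
  define M where "M = restrict_space lborel {0..<1::real}"
  define Q where "Q = distr M hyp_space h"
  have left_Nil: "left [] = 0" by (simp add: left_def)
  have left_snoc: "left (p @ [b]) = left p + (if b then l (p @ [False]) else 0)" for p b
    by (simp add: left_def nth_append cong: if_cong sum.cong_simp)
  have pre_0: "pre 0 U = []" and pre_Suc: "pre (Suc n) U = pre n U @ [left (pre n U) + l (pre n U @ [False]) \<le> U]" for n U
    by (simp_all add: pre_def)
  \<comment> \<open>Since the intervals are half-open, a word of weight 0 has an empty interval and
    is never read.\<close>
  have pre_iff: "pre n U = p \<longleftrightarrow> length p = n \<and> U \<in> {left p ..< left p + l p}" if "U \<in> {0..<1}" for n U p
  proof (induction n arbitrary: p)
    case 0
    then show ?case using that by (auto simp: pre_0 left_Nil l_Nil)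
  next
    case (Suc n)
    show ?case
    proof (cases p rule: rev_cases)
      case (snoc q b)
      have "pre (Suc n) U = p \<longleftrightarrow> pre n U = q \<and> b = (left q + l (q @ [False]) \<le> U)"
        by (auto simp: pre_Suc snoc)
      also have "\<dots> \<longleftrightarrow> length p = Suc n \<and> U \<in> {left p ..< left p + l p}"
        unfolding Suc.IH using l_nonneg[of "q @ [False]"] l_nonneg[of "q @ [True]"] l_split[of q]
        by (cases b) (auto simp: snoc left_snoc)
      finally show ?thesis .
    qed (simp add: pre_Suc)
  qed
  have bounds: "0 \<le> left p \<and> left p + l p \<le> 1" for p
  proof (induction p rule: rev_induct)
    case (snoc b p)
    then show ?case
      using l_nonneg[of "p @ [False]"] l_nonneg[of "p @ [True]"] l_split[of p] by (cases b) (auto simp: left_snoc)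
  qed (simp add: left_Nil l_Nil)
  have space_M: "space M = {0..<1}" by (simp add: M_def space_restrict_space)
  have vim: "pre n -` {p} \<inter> space M = (if length p = n then {left p ..< left p + l p} else {})" for n p
  proof -
    have "pre n -` {p} \<inter> {0..<1} = {0..<1} \<inter> (if length p = n then {left p ..< left p + l p} else {})"
    proof (rule set_eqI)
      fix U
      show "U \<in> pre n -` {p} \<inter> {0..<1} \<longleftrightarrow> U \<in> {0..<1} \<inter> (if length p = n then {left p ..< left p + l p} else {})"
        using pre_iff[of U n p] by (cases "U \<in> {0..<1}") auto
    qed
    then show ?thesis unfolding space_M using bounds[of p] by auto
  qed
  have sub: "{left p ..< left p + l p} \<subseteq> {0..<1}" for p using bounds[of p] by auto
  have emeasure_M: "emeasure M {left p ..< left p + l p} = ennreal (l p)" for p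
    unfolding M_def using sub[of p] l_nonneg[of p]
    by (subst emeasure_restrict_space) (auto simp: emeasure_lborel_Ico)
  have pre_meas: "pre n \<in> M \<rightarrow>\<^sub>M count_space UNIV" for n
  proof (rule measurable_count_space_eq2_countable[THEN iffD2], intro conjI ballI)
    fix p
    show "pre n -` {p} \<inter> space M \<in> sets M"
      unfolding vim unfolding M_def using sub[of p] by (subst sets_restrict_space_iff) auto
  qed auto
  have h_meas: "h \<in> M \<rightarrow>\<^sub>M hyp_space"
  proof (rule measurable_into_hyp_space)
    fix i show "(\<lambda>U. h U i) \<in> M \<rightarrow>\<^sub>M count_space UNIV"
      unfolding h_def by (rule measurable_compose[OF pre_meas]) simp
  qed
  have prefix: "map (h U) [0..<n] = pre n U" for U n
    by (induction n) (simp_all add: pre_0 h_def pre_Suc)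
  have "prob_space M"
    using emeasure_M[of "[]"] by (intro prob_spaceI) (simp add: space_M left_Nil l_Nil)
  then interpret M: prob_space M .
  show thesis
  proof
    show "prob_space Q" unfolding Q_def by (rule M.prob_space_distr[OF h_meas])
    show "sets Q = sets hyp_space" by (simp add: Q_def)
    fix p
    have "{g \<in> space hyp_space. map g [0..<length p] = p} \<in> sets hyp_space"
    proof -
      have "{g \<in> space hyp_space. \<forall>i<length p. g i = p ! i} \<in> sets hyp_space" by measurable
      moreover have "map g [0..<length p] = p \<longleftrightarrow> (\<forall>i<length p. g i = p ! i)" for g
        by (subst list_eq_iff_nth_eq) simp
      ultimately show ?thesis by simp
    qed
    then have "measure Q {g. map g [0..<length p] = p} = measure M (h -` {g. map g [0..<length p] = p} \<inter> space M)"
      unfolding Q_def by (intro measure_distr[OF h_meas]) simp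
    also have "h -` {g. map g [0..<length p] = p} \<inter> space M = pre (length p) -` {p} \<inter> space M"
      by (auto simp: prefix)
    also have "measure M \<dots> = l p"
      unfolding vim using emeasure_M[of p] l_nonneg[of p] by (simp add: measure_def)
    finally show "measure Q {g. map g [0..<length p] = p} = l p" .
  qed
qed

text \<open>Along a diagonal subsequence the frequency of every finite prefix converges; the limits
  inherit additivity and so are the prefix weights of a measure. Consistency with a dataset depends
  on finitely many coordinates, so its frequency converges to its probability.\<close>

lemma limit_of_empirical_measures:
  fixes hs :: "nat \<Rightarrow> 'x :: countable \<Rightarrow> bool"
  obtains Q and k :: "nat \<Rightarrow> nat" where "prob_space Q" "sets Q = sets hyp_space" "strict_mono k"
    and "\<And>S. (\<lambda>n. real (card {t. t < k n \<and> consistent (hs t) S}) / real (k n)) \<longlonglongrightarrow> measure Q {h. consistent h S}"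
proof -
  define pr where "pr N h = map (\<lambda>i. h (from_nat i :: 'x)) [0..<N]" for N and h :: "'x \<Rightarrow> bool"
  define f where "f T p = real (card {t. t < T \<and> pr (length p) (hs t) = p}) / real T" for T p
  have pr_Suc: "pr (Suc N) h = pr N h @ [h (from_nat N)]" for N h by (simp add: pr_def)
  have f_bound: "norm (f T p) \<le> 1" for T p
  proof -
    have "card {t. t < T \<and> pr (length p) (hs t) = p} \<le> card {..<T}" by (intro card_mono) auto
    then show ?thesis by (simp add: f_def divide_le_eq)
  qed
  obtain k where k: "strict_mono k" "\<And>p. \<exists>l. (\<lambda>n. f (k n) p) \<longlonglongrightarrow> l"
    using function_convergent_subsequence[of "UNIV :: bool list set" f 1] f_bound by auto
  define l where "l p = lim (\<lambda>n. f (k n) p)" for p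
  have lim: "(\<lambda>n. f (k n) p) \<longlonglongrightarrow> l p" for p
    unfolding l_def using k(2)[of p] by (metis limI)
  have "\<forall>\<^sub>F n in sequentially. f (k n) [] = 1"
    using eventually_gt_at_top[of 0]
  proof eventually_elim
    case (elim n)
    then have "0 < k n" using strict_mono_imp_increasing[OF k(1), of n] by linarith
    then show ?case by (simp add: f_def pr_def)
  qed
  then have l_Nil: "l [] = 1"
    using lim[of "[]"] by (metis LIMSEQ_unique tendsto_eventually)
  have l_nonneg: "0 \<le> l p" for p
    by (rule LIMSEQ_le_const[OF lim]) (auto simp: f_def)
  have f_split: "f T p = f T (p @ [False]) + f T (p @ [True])" for T p
  proof -
    have "{t. t < T \<and> pr (length p) (hs t) = p} =
        {t. t < T \<and> pr (length (p @ [False])) (hs t) = p @ [False]} \<union>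
        {t. t < T \<and> pr (length (p @ [True])) (hs t) = p @ [True]}"
      by (auto simp: pr_Suc)
    then have "card {t. t < T \<and> pr (length p) (hs t) = p} =
        card {t. t < T \<and> pr (length (p @ [False])) (hs t) = p @ [False]} +
        card {t. t < T \<and> pr (length (p @ [True])) (hs t) = p @ [True]}"
      by (simp only:) (rule card_Un_disjoint, auto simp: pr_Suc)
    then show ?thesis by (simp add: f_def add_divide_distrib)
  qed
  have l_split: "l p = l (p @ [False]) + l (p @ [True])" for p
    using tendsto_add[OF lim[of "p @ [False]"] lim[of "p @ [True]"]]
    unfolding f_split[symmetric] by (rule LIMSEQ_unique[OF lim[of p]])
  obtain Q' :: "(nat \<Rightarrow> bool) measure" where Q': "prob_space Q'" "sets Q' = sets hyp_space"
    and Q'_l: "\<And>p. measure Q' {h. map h [0..<length p] = p} = l p"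
    using measure_of_prefix_weights[of l] l_Nil l_nonneg l_split by metis
  interpret Q': prob_space Q' by fact
  note [measurable_cong] = Q'(2)
  \<comment> \<open>Only coordinates of the form \<open>to_nat x\<close> are read back, so the
    values of \<open>from_nat\<close> at other numbers have no effect.\<close>
  define Q where "Q = distr Q' hyp_space (\<lambda>g x. g (to_nat (x :: 'x)))"
  have meas: "(\<lambda>g x. g (to_nat (x :: 'x))) \<in> Q' \<rightarrow>\<^sub>M hyp_space"
    by (rule measurable_into_hyp_space) measurable
  show thesis
  proof
    show "prob_space Q" unfolding Q_def by (rule Q'.prob_space_distr[OF meas])
    show "sets Q = sets hyp_space" by (simp add: Q_def)
    show "strict_mono k" by (rule k)
    fix S :: "'x dataset"
    \<comment> \<open>A prefix long enough to contain all points of \<open>S\<close>; inserting 0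
      keeps \<open>Max\<close> defined for empty \<open>S\<close>.\<close>
    define N where "N = Suc (Max (insert 0 ((\<lambda>z. to_nat (fst z)) ` set S)))"
    have N: "to_nat (fst z) < N" if "z \<in> set S" for z
      unfolding N_def using that by (auto simp: less_Suc_eq_le intro!: Max_ge)
    define P where "P = {p. length p = N \<and> (\<forall>z\<in>set S. p ! to_nat (fst z) = snd z)}"
    have fin: "finite P"
      by (rule finite_subset[OF _ finite_lists_length_eq[of "UNIV :: bool set" N]]) (auto simp: P_def)
    have cons: "consistent h S \<longleftrightarrow> pr N h \<in> P" for h
      using N by (auto simp: consistent_iff P_def pr_def)
    have cons': "consistent (\<lambda>x. g (to_nat x)) S \<longleftrightarrow> map g [0..<N] \<in> P" for g
      using N by (auto simp: consistent_iff P_def)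
    have "real (card {t. t < T \<and> consistent (hs t) S}) / real T = (\<Sum>p\<in>P. f T p)" for T
    proof -
      have "{t. t < T \<and> consistent (hs t) S} = (\<Union>p\<in>P. {t. t < T \<and> pr N (hs t) = p})"
        by (auto simp: cons)
      then have "card {t. t < T \<and> consistent (hs t) S} = (\<Sum>p\<in>P. card {t. t < T \<and> pr N (hs t) = p})"
        by (simp only:) (rule card_UN_disjoint, use fin in auto)
      also have "\<dots> = (\<Sum>p\<in>P. card {t. t < T \<and> pr (length p) (hs t) = p})"
        by (intro sum.cong) (auto simp: P_def)
      finally show ?thesis by (simp add: f_def sum_divide_distrib)
    qed
    then have "(\<lambda>n. real (card {t. t < k n \<and> consistent (hs t) S}) / real (k n)) \<longlonglongrightarrow> (\<Sum>p\<in>P. l p)"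
      by (simp only:) (intro tendsto_sum lim)
    also have "(\<Sum>p\<in>P. l p) = measure Q {h. consistent h S}"
    proof -
      have Pset: "{g. map g [0..<N] = p} \<in> sets Q'" if "p \<in> P" for p
      proof -
        have "{g \<in> space hyp_space. \<forall>i<N. g i = p ! i} \<in> sets hyp_space" by measurable
        moreover have "map g [0..<N] = p \<longleftrightarrow> (\<forall>i<N. g i = p ! i)" for g
          using that by (auto simp: list_eq_iff_nth_eq P_def)
        ultimately show ?thesis by (simp add: Q')
      qed
      have "measure Q {h. consistent h S} = measure Q' ((\<lambda>g x. g (to_nat x)) -` {h. consistent h S} \<inter> space Q')"
        unfolding Q_def by (rule measure_distr[OF meas sets_consistent])
      also have "(\<lambda>g x. g (to_nat x)) -` {h. consistent h S} \<inter> space Q' = (\<Union>p\<in>P. {g. map g [0..<N] = p})"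
        using sets_eq_imp_space_eq[OF Q'(2)] by (auto simp: cons')
      also have "measure Q' \<dots> = (\<Sum>p\<in>P. measure Q' {g. map g [0..<N] = p})"
        using fin Pset by (intro Q'.finite_measure_finite_Union) (auto simp: disjoint_family_on_def)
      also have "\<dots> = (\<Sum>p\<in>P. l p)"
      proof (rule sum.cong[OF refl])
        fix p assume "p \<in> P"
        then have "length p = N" by (simp add: P_def)
        then show "measure Q' {g. map g [0..<N] = p} = l p" using Q'_l[of p] by simp
      qed
      finally show ?thesis ..
    qed
    finally show "(\<lambda>n. real (card {t. t < k n \<and> consistent (hs t) S}) / real (k n)) \<longlonglongrightarrow> measure Q {h. consistent h S}" .
  qed
qed

section \<open>Multiplicative weights and strong duality\<close>

text \<open>Each round plays an \<open>h\<close> that covers an \<open>r\<close> fraction of the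
  current weight and shrinks the weight of what it covers by \<open>1 - e\<close>. The total weight
  is then at most \<open>exp (- e * r * T)\<close>, while \<open>S\<close> alone retains
  \<open>pmf p S * (1 - e) ^ n\<close> after being covered \<open>n\<close> times; comparing
  logarithms bounds \<open>n\<close> from below. The dependence on \<open>S\<close> is an additive
  constant, negligible for large \<open>T\<close>.\<close>

lemma multiplicative_weights:
  fixes R :: "'h \<Rightarrow> 's \<Rightarrow> bool" and p :: "'s pmf"
  assumes best: "\<And>g :: 's \<Rightarrow> real. (\<And>S. 0 < g S \<and> g S \<le> 1) \<Longrightarrow>
      \<exists>h. r * measure_pmf.expectation p g \<le> measure_pmf.expectation p (\<lambda>S. g S * of_bool (R h S))"
    and r: "0 < r" and e: "0 < e" "e < 1"
  obtains hs :: "nat \<Rightarrow> 'h" where "\<And>S T. S \<in> set_pmf p \<Longrightarrow>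
      (1 - e) * (r * real T + ln (pmf p S) / e) \<le> real (card {t. t < T \<and> R (hs t) S})"
proof -
  define pick where "pick g = (SOME h. r * measure_pmf.expectation p g \<le> measure_pmf.expectation p (\<lambda>S. g S * of_bool (R h S)))"
    for g :: "'s \<Rightarrow> real"
  define g where "g t = rec_nat (\<lambda>_. 1) (\<lambda>_ f S. f S * (1 - e * of_bool (R (pick f) S))) t" for t
  define hs where "hs t = pick (g t)" for t
  have g_0: "g 0 = (\<lambda>_. 1)" and g_Suc: "g (Suc t) = (\<lambda>S. g t S * (1 - e * of_bool (R (hs t) S)))" for t
    by (simp_all add: g_def hs_def)
  have g_bounds: "0 < g t S \<and> g t S \<le> 1" for t S
  proof (induction t)
    case (Suc t)
    have "g t S * (1 - e * of_bool (R (hs t) S)) \<le> 1 * 1"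
      using Suc e by (intro mult_mono) auto
    then show ?case using Suc e by (auto simp: g_Suc)
  qed (simp add: g_0)
  have g_int: "integrable (measure_pmf p) (g t)" for t
    by (rule measure_pmf.integrable_const_bound[of _ 1]) (use g_bounds in \<open>auto simp: less_imp_le\<close>)
  have gR_int: "integrable (measure_pmf p) (\<lambda>S. g t S * of_bool (R h S))" for t h
    by (rule measure_pmf.integrable_const_bound[of _ 1]) (use g_bounds in \<open>auto simp: less_imp_le\<close>)
  have picked: "r * measure_pmf.expectation p (g t) \<le> measure_pmf.expectation p (\<lambda>S. g t S * of_bool (R (hs t) S))" for t
    unfolding hs_def pick_def by (rule someI_ex[OF best]) (rule g_bounds)
  have decay: "measure_pmf.expectation p (g T) \<le> exp (- (e * r) * real T)" for T
  proof (induction T)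
    case 0
    show ?case by (simp add: g_0)
  next
    case (Suc T)
    let ?E = "measure_pmf.expectation p (g T)"
    have "0 \<le> ?E" using g_bounds by (intro integral_nonneg_AE) (auto simp: less_imp_le)
    have "measure_pmf.expectation p (g (Suc T)) = (\<integral>S. g T S - e * (g T S * of_bool (R (hs T) S)) \<partial>measure_pmf p)"
      unfolding g_Suc by (intro Bochner_Integration.integral_cong) (auto simp: algebra_simps)
    also have "\<dots> = ?E - e * measure_pmf.expectation p (\<lambda>S. g T S * of_bool (R (hs T) S))"
      using g_int gR_int by simp
    also have "\<dots> \<le> ?E - e * (r * ?E)" using picked[of T] e by simp
    also have "\<dots> = (1 + - (e * r)) * ?E" by (simp add: algebra_simps)
    also have "\<dots> \<le> exp (- (e * r)) * exp (- (e * r) * real T)"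
      using Suc \<open>0 \<le> ?E\<close> exp_ge_add_one_self[of "- (e * r)"] by (intro mult_mono) auto
    also have "\<dots> = exp (- (e * r) * real (Suc T))" by (simp add: exp_add[symmetric] algebra_simps)
    finally show ?case .
  qed
  have g_eq: "g T S = (1 - e) ^ card {t. t < T \<and> R (hs t) S}" for T S
  proof (induction T)
    case (Suc T)
    have "{t. t < Suc T \<and> R (hs t) S} = (if R (hs T) S then insert T {t. t < T \<and> R (hs t) S} else {t. t < T \<and> R (hs t) S})"
      by (auto simp: less_Suc_eq)
    then show ?case using Suc by (simp add: g_Suc)
  qed (simp add: g_0)
  show thesis
  proof
    fix S T assume S: "S \<in> set_pmf p"
    let ?n = "card {t. t < T \<and> R (hs t) S}"
    have pos: "0 < pmf p S" using S by (simp add: pmf_positive)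
    have "pmf p S * g T S = measure_pmf.expectation p (\<lambda>z. indicator {S} z * g T S)"
      by (simp add: measure_pmf_single)
    also have "\<dots> \<le> measure_pmf.expectation p (g T)"
    proof (rule integral_mono[OF _ g_int])
      show "integrable (measure_pmf p) (\<lambda>z. indicator {S} z * g T S)"
        by (rule measure_pmf.integrable_const_bound[of _ 1]) (use g_bounds in \<open>auto simp: indicator_def less_imp_le\<close>)
    qed (use g_bounds in \<open>auto simp: indicator_def less_imp_le\<close>)
    also have "\<dots> \<le> exp (- (e * r) * real T)" by (rule decay)
    finally have "pmf p S * (1 - e) ^ ?n \<le> exp (- (e * r) * real T)" by (simp add: g_eq)
    then have "ln (pmf p S * (1 - e) ^ ?n) \<le> - (e * r) * real T"
      using pos e by (subst ln_le_cancel_iff[symmetric, of _ "exp (- (e * r) * real T)", simplified ln_exp, symmetric]) auto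
    then have "ln (pmf p S) + real ?n * ln (1 - e) \<le> - (e * r) * real T"
      using pos e by (simp add: ln_mult ln_realpow)
    \<comment> \<open>This bound on the logarithm is the source of the factor \<open>1 - e\<close>
      in the conclusion.\<close>
    moreover have "- (e / (1 - e)) \<le> ln (1 - e)"
    proof -
      have "ln (1 / (1 - e)) \<le> 1 / (1 - e) - 1" using e by (intro ln_le_minus_one) auto
      also have "\<dots> = e / (1 - e)" using e by (simp add: field_simps)
      finally show ?thesis using e by (simp add: ln_div)
    qed
    then have "real ?n * - (e / (1 - e)) \<le> real ?n * ln (1 - e)" by (intro mult_left_mono) auto
    ultimately have "ln (pmf p S) + e * (r * real T) \<le> real ?n * e / (1 - e)" by simp
    then have "(1 - e) / e * (ln (pmf p S) + e * (r * real T)) \<le> (1 - e) / e * (real ?n * e / (1 - e))"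
      using e by (intro mult_left_mono) auto
    moreover have "(1 - e) / e * (real ?n * e / (1 - e)) = real ?n" using e by simp
    moreover have "(1 - e) / e * (ln (pmf p S) + e * (r * real T)) = (1 - e) * (r * real T + ln (pmf p S) / e)"
      using e by (simp add: field_simps)
    ultimately show "(1 - e) * (r * real T + ln (pmf p S) / e) \<le> real ?n" by simp
  qed
qed

text \<open>If every hypothesis covered at most an \<open>r\<close> fraction of the weights
  \<open>pmf p S * g S\<close>, these weights divided by \<open>r * ?E\<close> would be a fractional
  clique of size \<open>1 / r\<close>, more than \<open>omega_star H n\<close> allows.\<close>

lemma fractional_clique_exists_heavy:
  fixes H :: "('x :: countable \<Rightarrow> bool) set" and g :: "'x dataset \<Rightarrow> real"
  assumes om: "omega_star H n < ennreal (1 / r)" and r: "0 < r"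
    and p: "set_pmf p = contra_vertices H n" and g: "\<And>S. 0 < g S \<and> g S \<le> 1"
  shows "\<exists>h. r * measure_pmf.expectation p g \<le> measure_pmf.expectation p (\<lambda>S. g S * of_bool (consistent h S))"
proof (rule ccontr)
  assume "\<not> ?thesis"
  then have light: "measure_pmf.expectation p (\<lambda>S. g S * of_bool (consistent h S)) \<le> r * measure_pmf.expectation p g" for h
    by (meson linorder_not_le less_imp_le)
  let ?V = "contra_vertices H n" and ?E = "measure_pmf.expectation p g"
  have g_int: "integrable (measure_pmf p) g"
    by (rule measure_pmf.integrable_const_bound[of _ 1]) (use g in \<open>auto simp: less_imp_le\<close>)
  have gc_int: "integrable (measure_pmf p) (\<lambda>S. g S * of_bool (consistent h S))" for h
    by (rule measure_pmf.integrable_const_bound[of _ 1]) (use g in \<open>auto simp: less_imp_le\<close>)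
  have "0 \<le> ?E" using g by (intro integral_nonneg_AE) (auto simp: less_imp_le)
  moreover have "?E \<noteq> 0"
  proof
    assume "?E = 0"
    then have "AE S in measure_pmf p. g S = 0"
      using g g_int by (subst (asm) integral_nonneg_eq_0_iff_AE) (auto simp: less_imp_le)
    moreover obtain S where "S \<in> set_pmf p" using set_pmf_not_empty[of p] by blast
    ultimately have "g S = 0" by (simp add: AE_measure_pmf_iff)
    then show False using g[of S] by simp
  qed
  ultimately have E: "0 < ?E" by simp
  define w where "w S = g S / (r * ?E)" for S
  have w: "0 < w S" for S using g[of S] r E by (simp add: w_def)
  define d where "d S = pmf p S * w S" for S
  have d_eq: "ennreal (d S) = ennreal (pmf p S) * ennreal (w S)" for S
    using w[of S] by (simp add: d_def ennreal_mult)
  have "fractional_clique ?V contra_adj d"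
    unfolding fractional_clique_def
  proof (intro conjI ballI allI impI)
    show "0 \<le> d S" for S using w[of S] by (simp add: d_def)
    fix I assume I: "independent_set ?V contra_adj I"
    \<comment> \<open>Every independent set consists of datasets consistent with one hypothesis,
      namely this one; it may lie outside \<open>H\<close>.\<close>
    define h where "h x \<longleftrightarrow> (\<exists>S\<in>I. (x, True) \<in> set S)" for x
    have cons: "consistent h S" if "S \<in> I" for S
      unfolding consistent_iff
    proof
      fix z assume z: "z \<in> set S"
      show "h (fst z) = snd z"
      proof (cases "snd z")
        case True
        then show ?thesis using z that by (cases z) (auto simp: h_def)
      next
        case False
        then have "(fst z, False) \<in> set S" using z by (cases z) auto
        then have "(fst z, True) \<notin> set S'" if "S' \<in> I" for S'
          using I \<open>S \<in> I\<close> that unfolding independent_set_def contra_adj_def by blast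
        then show ?thesis using False by (auto simp: h_def)
      qed
    qed
    have "(\<Sum>\<^sub>\<infinity>S\<in>I. ennreal (d S)) = (\<integral>\<^sup>+S. ennreal (d S) * indicator I S \<partial>count_space UNIV)"
      by (simp add: infsum_ennreal_eq_nn_integral nn_integral_count_space_indicator)
    also have "\<dots> \<le> (\<integral>\<^sup>+S. ennreal (pmf p S) * ennreal (g S * of_bool (consistent h S) / (r * ?E)) \<partial>count_space UNIV)"
      unfolding d_eq w_def using cons by (intro nn_integral_mono) (auto simp: indicator_def)
    also have "\<dots> = (\<integral>\<^sup>+S. ennreal (g S * of_bool (consistent h S) / (r * ?E)) \<partial>measure_pmf p)"
      by (simp add: nn_integral_measure_pmf)
    also have "\<dots> = ennreal (\<integral>S. g S * of_bool (consistent h S) / (r * ?E) \<partial>measure_pmf p)"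
      using gc_int g r E by (intro nn_integral_eq_integral) (auto simp: less_imp_le)
    also have "\<dots> = ennreal (measure_pmf.expectation p (\<lambda>S. g S * of_bool (consistent h S)) / (r * ?E))"
      by simp
    also have "\<dots> \<le> 1" using light[of h] r E by (simp add: divide_le_eq)
    finally show "(\<Sum>\<^sub>\<infinity>S\<in>I. ennreal (d S)) \<le> 1" .
  qed
  then have "fc_size ?V d \<le> omega_star H n"
    unfolding omega_star_def fractional_clique_number_def by (intro SUP_upper) auto
  moreover have "fc_size ?V d = ennreal (1 / r)"
  proof -
    have "fc_size ?V d = (\<integral>\<^sup>+S. ennreal (d S) * indicator ?V S \<partial>count_space UNIV)"
      by (simp add: fc_size_def infsum_ennreal_eq_nn_integral nn_integral_count_space_indicator)
    also have "\<dots> = (\<integral>\<^sup>+S. ennreal (pmf p S) * ennreal (g S / (r * ?E)) \<partial>count_space UNIV)"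
      unfolding d_eq w_def by (intro nn_integral_cong) (auto simp: indicator_def p[symmetric] set_pmf_iff)
    also have "\<dots> = (\<integral>\<^sup>+S. ennreal (g S / (r * ?E)) \<partial>measure_pmf p)"
      by (simp add: nn_integral_measure_pmf)
    also have "\<dots> = ennreal (\<integral>S. g S / (r * ?E) \<partial>measure_pmf p)"
      using g_int g r E by (intro nn_integral_eq_integral) (auto simp: less_imp_le)
    also have "(\<integral>S. g S / (r * ?E) \<partial>measure_pmf p) = 1 / r" using E by simp
    finally show ?thesis .
  qed
  ultimately show False using om by simp
qed

text \<open>The empirical measures of the hypotheses played converge to \<open>Q\<close>, and the
  additive error \<open>ln (pmf p S) / (e * T)\<close> vanishes for each fixed \<open>S\<close>. The
  factor \<open>1 - e\<close> remains in the limit.\<close>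

lemma strong_duality:
  fixes H :: "('x :: countable \<Rightarrow> bool) set"
  assumes om: "omega_star H n < ennreal (1 / r)" and r: "0 < r" and e: "0 < e" "e < 1"
    and ne: "contra_vertices H n \<noteq> {}"
  obtains Q where "prob_space Q" "sets Q = sets hyp_space"
    and "\<And>S. S \<in> contra_vertices H n \<Longrightarrow> (1 - e) * r \<le> measure Q {h. consistent h S}"
proof -
  let ?V = "contra_vertices H n"
  \<comment> \<open>A geometric law on an enumeration of the vertices gives every vertex positive
    prior mass, as the bound with \<open>ln (pmf p S)\<close> requires.\<close>
  define p where "p = map_pmf (from_nat_into ?V) (geometric_pmf (1 / 2))"
  have p: "set_pmf p = ?V"
    using range_from_nat_into[OF ne] by (simp add: p_def set_pmf_geometric)
  obtain hs where hs: "\<And>S T. S \<in> set_pmf p \<Longrightarrow>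
      (1 - e) * (r * real T + ln (pmf p S) / e) \<le> real (card {t. t < T \<and> consistent (hs t) S})"
    using multiplicative_weights[OF fractional_clique_exists_heavy[OF om r p] r e] by metis
  obtain Q and k :: "nat \<Rightarrow> nat" where Q: "prob_space Q" "sets Q = sets hyp_space" and k: "strict_mono k"
    and lim: "\<And>S. (\<lambda>n. real (card {t. t < k n \<and> consistent (hs t) S}) / real (k n)) \<longlonglongrightarrow> measure Q {h. consistent h S}"
    by (rule limit_of_empirical_measures[of hs]) (rule that)
  show thesis
  proof (rule that[OF Q])
    fix S assume S: "S \<in> ?V"
    have "(\<lambda>T. (1 - e) * (r + ln (pmf p S) / e * inverse (real T))) \<longlonglongrightarrow> (1 - e) * (r + ln (pmf p S) / e * 0)"
      by (intro tendsto_intros LIMSEQ_inverse_real_of_nat[THEN LIMSEQ_imp_Suc])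
    then have "(\<lambda>n. (1 - e) * (r + ln (pmf p S) / e * inverse (real (k n)))) \<longlonglongrightarrow> (1 - e) * r"
      using LIMSEQ_subseq_LIMSEQ[OF _ k] by (force simp: o_def)
    then show "(1 - e) * r \<le> measure Q {h. consistent h S}"
    proof (rule LIMSEQ_le[OF _ lim[of S]], intro exI allI impI)
      fix n :: nat assume "1 \<le> n"
      then have "0 < k n" using strict_mono_imp_increasing[OF k, of n] by linarith
      then have "(1 - e) * (r + A * inverse (real (k n))) = (1 - e) * (r * real (k n) + A) / real (k n)" for A
        by (simp add: field_simps)
      then show "(1 - e) * (r + ln (pmf p S) / e * inverse (real (k n))) \<le> real (card {t. t < k n \<and> consistent (hs t) S}) / real (k n)"
        using hs[of S "k n"] S p by (simp only:) (intro divide_right_mono, auto)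
    qed
  qed
qed

section \<open>From duality to weak learners\<close>

text \<open>A pmf is a density against counting measure, and countable sums commute with nonnegative
  integrals.\<close>

lemma nn_integral_pmf_swap:
  fixes p :: "'a :: countable pmf"
  assumes "\<And>z. f z \<in> borel_measurable M"
  shows "(\<integral>\<^sup>+z. (\<integral>\<^sup>+h. f z h \<partial>M) \<partial>measure_pmf p) = (\<integral>\<^sup>+h. (\<integral>\<^sup>+z. f z h \<partial>measure_pmf p) \<partial>M)"
proof -
  have "(\<integral>\<^sup>+z. (\<integral>\<^sup>+h. f z h \<partial>M) \<partial>measure_pmf p) = (\<integral>\<^sup>+z. (\<integral>\<^sup>+h. ennreal (pmf p z) * f z h \<partial>M) \<partial>count_space UNIV)"
    using assms by (simp add: nn_integral_measure_pmf nn_integral_cmult)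
  also have "\<dots> = (\<integral>\<^sup>+h. (\<integral>\<^sup>+z. ennreal (pmf p z) * f z h \<partial>count_space UNIV) \<partial>M)"
    using assms by (intro nn_integral_count_space_nn_integral[symmetric]) auto
  finally show ?thesis by (simp add: nn_integral_measure_pmf)
qed

lemma prob_consistent_replicate_pmf:
  "emeasure (measure_pmf (replicate_pmf n D)) {S. consistent h S} = ennreal ((1 - loss D h) ^ n)"
proof -
  have "emeasure (measure_pmf (replicate_pmf n D)) {S. consistent h S}
      = (\<integral>\<^sup>+S. indicator {S. consistent h S} S \<partial>measure_pmf (replicate_pmf n D))" by simp
  also have "(\<lambda>S. indicator {S. consistent h S} S) = (\<lambda>S. prod_list (map (\<lambda>z. indicator {z. h (fst z) = snd z} z) S) :: ennreal)"
  proof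
    fix S show "indicator {S. consistent h S} S = (prod_list (map (\<lambda>z. indicator {z. h (fst z) = snd z} z) S) :: ennreal)"
      by (induction S) (simp_all add: consistent_iff indicator_def of_bool_conj)
  qed
  also have "(\<integral>\<^sup>+S. \<dots> S \<partial>measure_pmf (replicate_pmf n D)) = (\<integral>\<^sup>+z. indicator {z. h (fst z) = snd z} z \<partial>measure_pmf D) ^ n"
    by (rule nn_integral_replicate_pmf_prod_list)
  also have "(\<integral>\<^sup>+z. indicator {z. h (fst z) = snd z} z \<partial>measure_pmf D) = ennreal (1 - loss D h)"
  proof -
    have "{z. h (fst z) = snd z} = space (measure_pmf D) - {(x, y). h x \<noteq> y}" by auto
    then show ?thesis
      using measure_pmf.prob_compl[of "{(x, y). h x \<noteq> y}" D] by (simp add: loss_def measure_pmf.emeasure_eq_measure)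
  qed
  finally show ?thesis by (simp add: ennreal_power)
qed

lemma weak_learner_of_omega_star_less:
  fixes H :: "('x :: countable \<Rightarrow> bool) set"
  assumes om: "omega_star H n < 2 ^ n"
  obtains Q g c where "0 < g" "g \<le> 1 / 2" "0 < c" "weak_learner H Q (1 / 2 - g) c"
proof (cases "contra_vertices H n = {}")
  case True
  \<comment> \<open>Without vertices there are no realizable distributions, so any \<open>Q\<close>
    is a weak learner vacuously.\<close>
  have "\<not> realizable_dist H D" for D
    using realizable_data_of_support[of H D _ n] True set_pmf_not_empty[of "replicate_pmf n D"] by blast
  then have "weak_learner H (return hyp_space undefined) (1 / 2 - 1 / 2) 1"
    by (auto simp: weak_learner_def intro!: prob_space_return)
  then show thesis by (rule that[rotated 3]) auto
next
  case False
  obtain w where w: "omega_star H n = ennreal w" "0 \<le> w"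
    using om by (cases "omega_star H n") auto
  have "ennreal w < ennreal (2 ^ n)" using om w by (simp flip: ennreal_power)
  then have "w < 2 ^ n" using w by (simp add: ennreal_less_iff)
  then obtain y where y: "w < y" "y < 2 ^ n" using dense by blast
  define r where "r = 1 / y"
  have y0: "0 < y" using y w by linarith
  then have r: "0 < r" "(1 / 2) ^ n < r" "omega_star H n < ennreal (1 / r)"
    using y w by (auto simp: r_def power_one_over ennreal_lessI frac_less2)
  \<comment> \<open>The gap between \<open>q\<close> and \<open>r\<close> absorbs the factor lost in
    strong duality: \<open>e = 1 - q / r\<close> makes \<open>(1 - e) * r = q\<close>.\<close>
  obtain q where q: "(1 / 2) ^ n < q" "q < r" using r(2) dense by blast
  have q0: "0 < q" by (rule less_trans[OF _ q(1)]) simp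
  obtain Q where Q: "prob_space Q" "sets Q = sets hyp_space"
    and cover: "\<And>S. S \<in> contra_vertices H n \<Longrightarrow> (1 - (1 - q / r)) * r \<le> measure Q {h. consistent h S}"
  proof (rule strong_duality[OF r(3) r(1) _ _ False, of "1 - q / r"])
    show "0 < 1 - q / r" "1 - q / r < 1" using q0 q r by auto
  qed (rule that)
  interpret Q: prob_space Q by fact
  note [measurable_cong] = Q(2)
  \<comment> \<open>Half of the surplus of \<open>q\<close> over \<open>1 / 2 ^ n\<close> pays for
    raising 1/2 to \<open>1 / 2 + g\<close>; the other half is the guaranteed mass of good
    hypotheses.\<close>
  define c where "c = (q - (1 / 2) ^ n) / 2"
  have c: "0 < c" using q by (simp add: c_def)
  have "((\<lambda>g. (1 / 2 + g) ^ n) \<longlongrightarrow> (1 / 2 + 0 :: real) ^ n) (at_right 0)"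
    by (intro tendsto_intros)
  then have "\<forall>\<^sub>F g in at_right 0. (1 / 2 + g :: real) ^ n < (1 / 2) ^ n + c"
    using c by (intro order_tendstoD) auto
  moreover have "\<forall>\<^sub>F g in at_right 0. 0 < (g :: real) \<and> g < 1 / 2"
    by (rule eventually_at_right_field[THEN iffD2]) (auto intro: exI[of _ "1/2"])
  ultimately have "\<forall>\<^sub>F g in at_right 0. (1 / 2 + g :: real) ^ n < (1 / 2) ^ n + c \<and> 0 < g \<and> g < 1 / 2"
    by eventually_elim auto
  then obtain g :: real where g: "(1 / 2 + g) ^ n < (1 / 2) ^ n + c" "0 < g" "g < 1 / 2"
    using eventually_happens'[OF trivial_limit_at_right_real] by blast
  have "c \<le> measure Q {h. loss D h \<le> 1 / 2 - g}" if D: "realizable_dist H D" for D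
  proof -
    let ?G = "{h. loss D h \<le> 1 / 2 - g}"
    have "{h \<in> space hyp_space. loss D h \<le> 1 / 2 - g} \<in> sets hyp_space" by measurable
    then have G: "?G \<in> sets Q" by (simp add: Q)
    have "ennreal q = (\<integral>\<^sup>+S. ennreal q \<partial>measure_pmf (replicate_pmf n D))"
      by (simp add: measure_pmf.emeasure_space_1)
    also have "\<dots> \<le> (\<integral>\<^sup>+S. emeasure Q {h. consistent h S} \<partial>measure_pmf (replicate_pmf n D))"
      using cover realizable_data_of_support[OF D] r
      by (intro nn_integral_mono_AE) (auto simp: AE_measure_pmf_iff Q.emeasure_eq_measure)
    also have "\<dots> = (\<integral>\<^sup>+S. (\<integral>\<^sup>+h. indicator {h. consistent h S} h \<partial>Q) \<partial>measure_pmf (replicate_pmf n D))"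
      by (simp add: Q)
    also have "\<dots> = (\<integral>\<^sup>+h. (\<integral>\<^sup>+S. indicator {h. consistent h S} h \<partial>measure_pmf (replicate_pmf n D)) \<partial>Q)"
      by (rule nn_integral_pmf_swap) measurable
    also have "\<dots> = (\<integral>\<^sup>+h. ennreal ((1 - loss D h) ^ n) \<partial>Q)"
    proof (rule nn_integral_cong)
      fix h
      have "(\<integral>\<^sup>+S. indicator {h. consistent h S} h \<partial>measure_pmf (replicate_pmf n D))
          = (\<integral>\<^sup>+S. indicator {S. consistent h S} S \<partial>measure_pmf (replicate_pmf n D))"
        by (intro nn_integral_cong) (simp add: indicator_def)
      then show "(\<integral>\<^sup>+S. indicator {h. consistent h S} h \<partial>measure_pmf (replicate_pmf n D)) = ennreal ((1 - loss D h) ^ n)"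
        by (simp add: prob_consistent_replicate_pmf)
    qed
    \<comment> \<open>A hypothesis outside \<open>?G\<close> fits each example with probability
      below \<open>1 / 2 + g\<close>; one inside fits the sample with probability at most 1.\<close>
    also have "\<dots> \<le> (\<integral>\<^sup>+h. indicator ?G h + ennreal ((1 / 2 + g) ^ n) \<partial>Q)"
    proof (rule nn_integral_mono)
      fix h
      show "ennreal ((1 - loss D h) ^ n) \<le> indicator ?G h + ennreal ((1 / 2 + g) ^ n)"
      proof (cases "h \<in> ?G")
        case True
        have "ennreal ((1 - loss D h) ^ n) \<le> ennreal 1"
          by (intro ennreal_leI power_le_one) auto
        also have "\<dots> \<le> indicator ?G h + ennreal ((1 / 2 + g) ^ n)" using True by simp
        finally show ?thesis .
      next
        case False
        then show ?thesis by (auto intro!: ennreal_leI power_mono)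
      qed
    qed
    also have "\<dots> = emeasure Q ?G + ennreal ((1 / 2 + g) ^ n)"
      using G by (simp add: nn_integral_add Q.emeasure_space_1)
    also have "\<dots> = ennreal (measure Q ?G + (1 / 2 + g) ^ n)"
      using g by (simp add: Q.emeasure_eq_measure ennreal_plus)
    finally have "q \<le> measure Q ?G + (1 / 2 + g) ^ n"
      using g by (subst (asm) ennreal_le_iff) auto
    then have "q - ((1 / 2) ^ n + c) \<le> measure Q ?G" using g by linarith
    moreover have "q - ((1 / 2) ^ n + c) = c" by (simp add: c_def field_simps)
    ultimately show ?thesis by simp
  qed
  then have "weak_learner H Q (1 / 2 - g) c" using Q by (auto simp: weak_learner_def)
  then show thesis using g c by (intro that) auto
qed

section \<open>The exponential mechanism\<close>

text \<open>\<open>fit S h\<close> is \<open>exp (- k)\<close>, where \<open>k\<close> is the number of errors of \<open>h\<close> on \<open>S\<close>; \<open>gibbs Q S\<close> reweights the prior \<open>Q\<close> by it.\<close>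

definition fit :: "'x dataset \<Rightarrow> ('x \<Rightarrow> bool) \<Rightarrow> real" where
  "fit S h = prod_list (map (\<lambda>z. if h (fst z) \<noteq> snd z then exp (- 1) else 1) S)"

definition gibbs :: "('x \<Rightarrow> bool) measure \<Rightarrow> 'x dataset \<Rightarrow> ('x \<Rightarrow> bool) measure" where
  "gibbs Q S = density Q (\<lambda>h. ennreal (fit S h / (\<integral>h. fit S h \<partial>Q)))"

lemma fit_Nil: "fit [] = (\<lambda>_. 1)"
  and fit_Cons: "fit (z # S) = (\<lambda>h. (if h (fst z) \<noteq> snd z then exp (- 1) else 1) * fit S h)"
  by (simp_all add: fit_def fun_eq_iff)

lemma fit_pos: "0 < fit S h"
  by (induction S) (auto simp: fit_Nil fit_Cons)

lemma fit_nonneg [simp]: "0 \<le> fit S h"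
  by (rule less_imp_le[OF fit_pos])

lemma fit_le_1 [simp]: "fit S h \<le> 1"
proof (induction S)
  case (Cons z S)
  then have "(if h (fst z) \<noteq> snd z then exp (- 1) else 1) * fit S h \<le> 1 * 1" by (intro mult_mono) auto
  then show ?case by (simp add: fit_Cons)
qed (simp add: fit_Nil)

lemma fit_consistent: "consistent h S \<Longrightarrow> fit S h = 1"
  unfolding fit_def consistent_iff by (induction S) auto

lemma borel_measurable_fit [measurable]: "fit S \<in> borel_measurable hyp_space"
proof (induction S)
  case (Cons z S)
  note Cons [measurable]
  show ?case unfolding fit_Cons by measurable
qed (simp add: fit_Nil)

lemma fit_neighbouring:
  assumes "neighbouring S S'"
  shows "fit S h \<le> exp 1 * fit S' h"
proof -
  obtain i where len: "length S = length S'" and i: "i < length S"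
    and eq: "\<And>j. j < length S \<Longrightarrow> j \<noteq> i \<Longrightarrow> S ! j = S' ! j"
    using assms by (auto simp: neighbouring_def)
  let ?c = "\<lambda>z. if h (fst z) \<noteq> snd z then exp (- 1) else 1 :: real"
  have split: "fit U h = fit (take i U) h * ?c (U ! i) * fit (drop (Suc i) U) h" if "i < length U" for U
    by (subst id_take_nth_drop[OF that]) (simp add: fit_def)
  have take: "take i S = take i S'" and drop: "drop (Suc i) S = drop (Suc i) S'"
    using len i eq by (auto simp: list_eq_iff_nth_eq)
  have c: "?c z \<le> exp 1 * ?c z'" for z z'
  proof -
    have "?c z \<le> 1" by simp
    also have "\<dots> = exp 1 * exp (- 1 :: real)" by (simp add: exp_minus)
    also have "\<dots> \<le> exp 1 * ?c z'" by (intro mult_left_mono) auto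
    finally show ?thesis .
  qed
  have "fit S h = ?c (S ! i) * (fit (take i S) h * fit (drop (Suc i) S) h)"
    using split[OF i] by (simp add: mult_ac)
  also have "\<dots> \<le> exp 1 * ?c (S' ! i) * (fit (take i S) h * fit (drop (Suc i) S) h)"
    by (intro mult_right_mono c mult_nonneg_nonneg less_imp_le[OF fit_pos])
  also have "\<dots> = exp 1 * fit S' h"
    using split[of S'] i len take drop by (simp add: mult_ac)
  finally show ?thesis .
qed

context
  fixes Q :: "('x :: countable \<Rightarrow> bool) measure"
  assumes prob_Q: "prob_space Q" and sets_Q: "sets Q = sets hyp_space"
begin

interpretation Q: prob_space Q by (rule prob_Q)

declare sets_Q [measurable_cong]

lemma integrable_fit: "integrable Q (fit S)"
  by (rule Q.integrable_const_bound[of _ 1]) (use fit_pos fit_le_1 in \<open>auto intro!: AE_I2\<close>)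

lemma integrable_fit_indicator: "E \<in> sets hyp_space \<Longrightarrow> integrable Q (\<lambda>h. indicator E h * fit S h)"
  using integrable_real_mult_indicator[OF _ integrable_fit, of E S] by (simp add: sets_Q mult.commute)

lemma integral_fit_pos: "0 < (\<integral>h. fit S h \<partial>Q)"
proof -
  have "(\<integral>h. fit S h \<partial>Q) \<noteq> 0"
  proof
    assume "(\<integral>h. fit S h \<partial>Q) = 0"
    then have "AE h in Q. fit S h = 0"
      using integrable_fit fit_pos by (subst (asm) integral_nonneg_eq_0_iff_AE) (auto intro!: AE_I2)
    then have "AE h in Q. False" using fit_pos[of S] by (auto simp: less_imp_neq[THEN not_sym])
    then show False by simp
  qed
  moreover have "0 \<le> (\<integral>h. fit S h \<partial>Q)" by (intro integral_nonneg_AE) (auto intro!: AE_I2)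
  ultimately show ?thesis by (simp add: less_le)
qed

lemma emeasure_gibbs:
  assumes E: "E \<in> sets hyp_space"
  shows "emeasure (gibbs Q S) E = ennreal ((\<integral>h. indicator E h * fit S h \<partial>Q) / (\<integral>h. fit S h \<partial>Q))"
proof -
  let ?Z = "\<integral>h. fit S h \<partial>Q"
  have "emeasure (gibbs Q S) E = (\<integral>\<^sup>+h. ennreal (fit S h / ?Z) * indicator E h \<partial>Q)"
    unfolding gibbs_def using E by (intro emeasure_density) (auto simp: sets_Q)
  also have "\<dots> = (\<integral>\<^sup>+h. ennreal (indicator E h * fit S h / ?Z) \<partial>Q)"
    by (intro nn_integral_cong) (auto simp: indicator_def)
  also have "\<dots> = ennreal (\<integral>h. indicator E h * fit S h / ?Z \<partial>Q)"
    using integrable_fit_indicator[OF E] integral_fit_pos[of S] fit_pos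
    by (intro nn_integral_eq_integral) (auto intro!: AE_I2)
  finally show ?thesis by simp
qed

lemma sets_gibbs: "sets (gibbs Q S) = sets hyp_space"
  by (simp add: gibbs_def sets_Q)

lemma prob_space_gibbs: "prob_space (gibbs Q S)"
proof (rule prob_spaceI)
  have "space (gibbs Q S) = UNIV" using sets_eq_imp_space_eq[OF sets_gibbs] by simp
  moreover have "UNIV \<in> sets hyp_space" using sets.top[of hyp_space] by simp
  ultimately show "emeasure (gibbs Q S) (space (gibbs Q S)) = 1"
    using emeasure_gibbs[of UNIV S] integral_fit_pos[of S] by simp
qed

lemma measure_gibbs:
  assumes E: "E \<in> sets hyp_space"
  shows "measure (gibbs Q S) E = (\<integral>h. indicator E h * fit S h \<partial>Q) / (\<integral>h. fit S h \<partial>Q)"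
  unfolding measure_def emeasure_gibbs[OF E] using integral_fit_pos[of S] fit_pos
  by (intro enn2real_ennreal divide_nonneg_pos integral_nonneg_AE) (auto intro!: AE_I2)

text \<open>One changed example alters the numerator and the normalizing constant by a factor of at
  most \<open>exp 1\<close> each.\<close>

lemma gibbs_private:
  assumes nb: "neighbouring S S'" and E: "E \<in> sets hyp_space"
  shows "measure (gibbs Q S) E \<le> exp 2 * measure (gibbs Q S') E"
proof -
  have nb': "neighbouring S' S" using nb by (auto simp: neighbouring_def)
  let ?N = "\<lambda>S. \<integral>h. indicator E h * fit S h \<partial>Q" and ?Z = "\<lambda>S. \<integral>h. fit S h \<partial>Q"
  have "?N S \<le> (\<integral>h. exp 1 * (indicator E h * fit S' h) \<partial>Q)"
    using integrable_fit_indicator[OF E] fit_neighbouring[OF nb]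
    by (intro integral_mono integrable_mult_right) (auto simp: indicator_def)
  then have N: "?N S \<le> exp 1 * ?N S'" by simp
  have "?Z S' \<le> (\<integral>h. exp 1 * fit S h \<partial>Q)"
    using integrable_fit fit_neighbouring[OF nb'] by (intro integral_mono integrable_mult_right) auto
  then have Z: "?Z S' / exp 1 \<le> ?Z S" by (simp add: field_simps)
  have N0: "0 \<le> ?N S'" using fit_pos by (intro integral_nonneg_AE) (auto intro!: AE_I2)
  have "?N S / ?Z S \<le> exp 1 * ?N S' / (?Z S' / exp 1)"
    using N Z N0 integral_fit_pos by (intro frac_le) auto
  also have "\<dots> = exp 1 * exp 1 * (?N S' / ?Z S')" by simp
  also have "exp 1 * exp 1 = exp (2 :: real)" by (simp flip: exp_add)
  finally show ?thesis by (simp add: measure_gibbs[OF E])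
qed

text \<open>A hypothesis of loss at most \<open>a\<close> errs somewhere on the sample with
  probability at most \<open>m * a\<close>, which is the first term. One of loss above
  \<open>al\<close> has exponentially small mean weight, and dividing by the prior mass of good
  hypotheses gives the second.\<close>

lemma gibbs_failure:
  assumes c: "0 < c" "c \<le> measure Q {h. loss D h \<le> a}" and al: "0 \<le> al"
  shows "failure_prob (gibbs Q) D m al \<le> 2 * (real m * a) + 2 / c * exp (- ((1 - exp (- 1)) * al * real m))"
proof -
  let ?p = "measure_pmf (replicate_pmf m D)"
  \<comment> \<open>An error costs the factor \<open>exp (- 1)\<close>, so the mean weight of one
    example is \<open>1 - ?k * loss D h\<close>.\<close>
  let ?k = "1 - exp (- 1) :: real"
  define G where "G = {h. loss D h \<le> a}"
  define B where "B = {h. loss D h > al}"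
  \<comment> \<open>The exact mass of \<open>G\<close>, rather than its lower bound
    \<open>c\<close>, cancels in the first term of the bound; \<open>c\<close> replaces it only in
    the second.\<close>
  define q where "q = measure Q G"
  have "{h \<in> space hyp_space. loss D h \<le> a} \<in> sets hyp_space" "{h \<in> space hyp_space. loss D h > al} \<in> sets hyp_space"
    by measurable
  then have G [measurable]: "G \<in> sets hyp_space" and B [measurable]: "B \<in> sets hyp_space"
    by (simp_all add: G_def B_def)
  have q: "0 < q" "c \<le> q" using c by (auto simp: q_def G_def)
  define Y where "Y S = measure Q (G - {h. consistent h S})" for S
  define N where "N S = (\<integral>h. indicator B h * fit S h \<partial>Q)" for S
  have N0: "0 \<le> N S" for S unfolding N_def using fit_pos by (intro integral_nonneg_AE) (auto intro!: AE_I2)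
  \<comment> \<open>If most of the good hypotheses fit \<open>S\<close>, they bound the normalizing constant from below; otherwise
    \<open>Y S\<close> exceeds half of \<open>q\<close> and the claim is trivial.\<close>
  have pointwise: "measure (gibbs Q S) B \<le> 2 / q * (Y S + N S)" for S
  proof (cases "Y S \<le> q / 2")
    case True
    have "q - Y S = measure Q (G \<inter> {h. consistent h S})"
      using Q.finite_measure_Diff'[of G "{h. consistent h S}"] G sets_consistent[of S] by (simp add: q_def Y_def sets_Q)
    also have "\<dots> = (\<integral>h. indicator (G \<inter> {h. consistent h S}) h \<partial>Q)"
      using G sets_consistent[of S] by (simp add: sets_Q)
    also have "\<dots> \<le> (\<integral>h. fit S h \<partial>Q)"
    proof (rule integral_mono[OF _ integrable_fit])
      show "integrable Q (indicator (G \<inter> {h. consistent h S}) :: _ \<Rightarrow> real)"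
        using G sets_consistent[of S] by (intro integrable_real_indicator) (auto simp: sets_Q Q.emeasure_eq_measure)
      show "indicator (G \<inter> {h. consistent h S}) h \<le> fit S h" for h
        using fit_consistent[of h S] less_imp_le[OF fit_pos[of S h]] by (auto simp: indicator_def)
    qed
    finally have "q / 2 \<le> (\<integral>h. fit S h \<partial>Q)" using True by simp
    then have "measure (gibbs Q S) B \<le> N S / (q / 2)"
      unfolding measure_gibbs[OF B] N_def[symmetric] using q N0 by (intro divide_left_mono) auto
    also have "\<dots> \<le> 2 / q * (Y S + N S)" using q by (simp add: Y_def field_simps)
    finally show ?thesis .
  next
    case False
    have "measure (gibbs Q S) B \<le> 1" by (rule prob_space.prob_le_1[OF prob_space_gibbs])
    also have "1 \<le> 2 / q * Y S" using False q by (simp add: field_simps)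
    also have "\<dots> \<le> 2 / q * (Y S + N S)" using q N0 by (simp add: field_simps)
    finally show ?thesis .
  qed
  have a0: "0 \<le> a"
  proof (rule ccontr)
    assume "\<not> 0 \<le> a"
    then have "G = {}" using order_trans[OF loss_nonneg[of D]] by (auto simp: G_def)
    then show False using q by (simp add: q_def)
  qed
  have enn: "ennreal (2 / q) * (ennreal x + ennreal y) = ennreal (2 / q * (x + y))" if "0 \<le> x" "0 \<le> y" for x y
    using that q ennreal_mult[of "2 / q" "x + y"] ennreal_plus[of x y] by simp
  have Y_int: "(\<integral>\<^sup>+S. ennreal (Y S) \<partial>?p) \<le> ennreal (q * (real m * a))"
  proof -
    have "(\<integral>\<^sup>+S. ennreal (Y S) \<partial>?p) = (\<integral>\<^sup>+S. (\<integral>\<^sup>+h. indicator G h * indicator (- {h. consistent h S}) h \<partial>Q) \<partial>?p)"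
    proof (rule nn_integral_cong)
      fix S
      have "ennreal (Y S) = emeasure Q (G - {h. consistent h S})" by (simp add: Y_def Q.emeasure_eq_measure)
      also have "\<dots> = (\<integral>\<^sup>+h. indicator (G - {h. consistent h S}) h \<partial>Q)"
        using G sets_consistent[of S] by (simp add: sets_Q)
      also have "\<dots> = (\<integral>\<^sup>+h. indicator G h * indicator (- {h. consistent h S}) h \<partial>Q)"
        by (intro nn_integral_cong) (auto simp: indicator_def)
      finally show "ennreal (Y S) = (\<integral>\<^sup>+h. indicator G h * indicator (- {h. consistent h S}) h \<partial>Q)" .
    qed
    also have "\<dots> = (\<integral>\<^sup>+h. (\<integral>\<^sup>+S. indicator G h * indicator (- {h. consistent h S}) h \<partial>?p) \<partial>Q)"
    proof (rule nn_integral_pmf_swap)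
      fix S
      have "- {h. consistent h S} \<in> sets Q"
        using sets.compl_sets[OF sets_consistent[of S]] by (simp add: sets_Q Compl_eq_Diff_UNIV)
      then show "(\<lambda>h. indicator G h * indicator (- {h. consistent h S}) h :: ennreal) \<in> borel_measurable Q"
        by measurable
    qed
    also have "\<dots> \<le> (\<integral>\<^sup>+h. ennreal (real m * a) * indicator G h \<partial>Q)"
    proof (rule nn_integral_mono)
      fix h
      have "(\<integral>\<^sup>+S. indicator G h * indicator (- {h. consistent h S}) h \<partial>?p)
          = indicator G h * (\<integral>\<^sup>+S. indicator (- {S. consistent h S}) S \<partial>?p)"
        by (subst nn_integral_cmult[symmetric]) (auto intro!: nn_integral_cong simp: indicator_def)
      also have "(\<integral>\<^sup>+S. indicator (- {S. consistent h S}) S \<partial>?p) = ennreal (1 - (1 - loss D h) ^ m)"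
      proof -
        have "measure ?p {S. consistent h S} = (1 - loss D h) ^ m"
          using prob_consistent_replicate_pmf[of m D h]
          by (simp add: measure_pmf.emeasure_eq_measure)
        then show ?thesis
          using measure_pmf.prob_compl[of "{S. consistent h S}" "replicate_pmf m D"]
          by (simp add: measure_pmf.emeasure_eq_measure Compl_eq_Diff_UNIV)
      qed
      also have "\<dots> \<le> ennreal (real m * loss D h)"
        using Bernoulli_inequality[of "- loss D h" m] by (intro ennreal_leI) simp
      finally have "(\<integral>\<^sup>+S. indicator G h * indicator (- {h. consistent h S}) h \<partial>?p) \<le> indicator G h * ennreal (real m * loss D h)"
        by (simp add: mult_left_mono)
      also have "\<dots> \<le> ennreal (real m * a) * indicator G h"
        by (cases "h \<in> G") (auto simp: G_def intro!: ennreal_leI mult_left_mono)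
      finally show "(\<integral>\<^sup>+S. indicator G h * indicator (- {h. consistent h S}) h \<partial>?p) \<le> ennreal (real m * a) * indicator G h" .
    qed
    also have "\<dots> = ennreal (real m * a) * emeasure Q G"
      by (intro nn_integral_cmult_indicator) (simp add: sets_Q)
    also have "\<dots> = ennreal (q * (real m * a))"
      using q a0 by (simp add: Q.emeasure_eq_measure q_def[symmetric] mult.commute flip: ennreal_mult)
    finally show ?thesis .
  qed
  have N_int: "(\<integral>\<^sup>+S. ennreal (N S) \<partial>?p) \<le> ennreal (exp (- (?k * al * real m)))"
  proof -
    have "(\<integral>\<^sup>+S. ennreal (N S) \<partial>?p) = (\<integral>\<^sup>+S. (\<integral>\<^sup>+h. indicator B h * ennreal (fit S h) \<partial>Q) \<partial>?p)"
    proof (rule nn_integral_cong)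
      fix S
      have "ennreal (N S) = (\<integral>\<^sup>+h. ennreal (indicator B h * fit S h) \<partial>Q)"
        unfolding N_def using integrable_fit_indicator[OF B] fit_pos
        by (intro nn_integral_eq_integral[symmetric]) (auto intro!: AE_I2)
      then show "ennreal (N S) = (\<integral>\<^sup>+h. indicator B h * ennreal (fit S h) \<partial>Q)"
        by (simp add: indicator_def of_bool_def if_distrib if_distribR cong: if_cong)
    qed
    also have "\<dots> = (\<integral>\<^sup>+h. (\<integral>\<^sup>+S. indicator B h * ennreal (fit S h) \<partial>?p) \<partial>Q)"
      by (rule nn_integral_pmf_swap) measurable
    also have "\<dots> \<le> (\<integral>\<^sup>+h. ennreal (exp (- (?k * al * real m))) \<partial>Q)"
    proof (rule nn_integral_mono)
      fix h
      have "?k * loss D h \<le> 1 * 1" by (intro mult_mono) auto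
      then have kL: "?k * loss D h \<le> 1" by simp
      have enn_fit: "ennreal (fit S h) = prod_list (map (\<lambda>z. ennreal (if h (fst z) \<noteq> snd z then exp (- 1) else 1)) S)" for S :: "'x dataset"
      proof (induction S)
        case (Cons z S)
        then show ?case by (simp add: fit_Cons ennreal_mult)
      qed (simp add: fit_Nil)
      have "(\<integral>\<^sup>+S. ennreal (fit S h) \<partial>?p) = (\<integral>\<^sup>+z. ennreal (if h (fst z) \<noteq> snd z then exp (- 1) else 1) \<partial>measure_pmf D) ^ m"
        unfolding enn_fit by (rule nn_integral_replicate_pmf_prod_list)
      also have "(\<integral>\<^sup>+z. ennreal (if h (fst z) \<noteq> snd z then exp (- 1) else 1) \<partial>measure_pmf D) = ennreal (1 - ?k * loss D h)"
      proof -
        have "(\<integral>\<^sup>+z. ennreal (if h (fst z) \<noteq> snd z then exp (- 1) else 1) \<partial>measure_pmf D)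
            = ennreal (\<integral>z. (if h (fst z) \<noteq> snd z then exp (- 1) else 1) \<partial>measure_pmf D)"
          by (intro nn_integral_eq_integral measure_pmf.integrable_const_bound[of _ 1]) auto
        also have "(\<integral>z. (if h (fst z) \<noteq> snd z then exp (- 1) else 1) \<partial>measure_pmf D)
            = (\<integral>z. 1 - ?k * indicator {(x, y). h x \<noteq> y} z \<partial>measure_pmf D)"
          by (intro Bochner_Integration.integral_cong) (auto simp: indicator_def)
        also have "\<dots> = 1 - ?k * loss D h"
          by (subst Bochner_Integration.integral_diff) (auto simp: loss_def measure_pmf.emeasure_eq_measure)
        finally show ?thesis .
      qed
      also have "\<dots> ^ m = ennreal ((1 - ?k * loss D h) ^ m)"
        using kL by (simp add: ennreal_power)
      finally have fit_int: "(\<integral>\<^sup>+S. ennreal (fit S h) \<partial>?p) = ennreal ((1 - ?k * loss D h) ^ m)" .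
      show "(\<integral>\<^sup>+S. indicator B h * ennreal (fit S h) \<partial>?p) \<le> ennreal (exp (- (?k * al * real m)))"
      proof (cases "h \<in> B")
        case True
        have "?k * al \<le> ?k * loss D h" using True by (intro mult_left_mono) (auto simp: B_def)
        then have "(1 - ?k * loss D h) ^ m \<le> exp (- (?k * al)) ^ m"
          using kL exp_ge_add_one_self[of "- (?k * al)"] by (intro power_mono) linarith+
        also have "\<dots> = exp (- (?k * al * real m))" by (simp flip: exp_of_nat2_mult)
        finally show ?thesis using True fit_int by (simp add: ennreal_leI)
      qed simp
    qed
    also have "\<dots> = ennreal (exp (- (?k * al * real m)))" by (simp add: Q.emeasure_space_1)
    finally show ?thesis .
  qed
  have "ennreal (failure_prob (gibbs Q) D m al) = (\<integral>\<^sup>+S. ennreal (measure (gibbs Q S) B) \<partial>?p)"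
    unfolding failure_prob_def B_def space_hyp_space
    by (simp, intro nn_integral_eq_integral[symmetric] measure_pmf.integrable_const_bound[of _ 1])
       (auto simp: prob_space.prob_le_1[OF prob_space_gibbs])
  also have "\<dots> \<le> (\<integral>\<^sup>+S. ennreal (2 / q) * (ennreal (Y S) + ennreal (N S)) \<partial>?p)"
  proof (rule nn_integral_mono)
    fix S
    have "ennreal (2 / q) * (ennreal (Y S) + ennreal (N S)) = ennreal (2 / q * (Y S + N S))"
      using N0[of S] by (intro enn) (auto simp: Y_def)
    then show "ennreal (measure (gibbs Q S) B) \<le> ennreal (2 / q) * (ennreal (Y S) + ennreal (N S))"
      using ennreal_leI[OF pointwise[of S]] by (simp only:)
  qed
  also have "\<dots> = ennreal (2 / q) * ((\<integral>\<^sup>+S. ennreal (Y S) \<partial>?p) + (\<integral>\<^sup>+S. ennreal (N S) \<partial>?p))"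
    by (simp add: nn_integral_cmult nn_integral_add)
  also have "\<dots> \<le> ennreal (2 / q) * (ennreal (q * (real m * a)) + ennreal (exp (- (?k * al * real m))))"
    by (intro mult_left_mono add_mono Y_int N_int) auto
  also have "\<dots> = ennreal (2 / q * (q * (real m * a) + exp (- (?k * al * real m))))"
    using q a0 by (intro enn) auto
  finally have "failure_prob (gibbs Q) D m al \<le> 2 / q * (q * (real m * a) + exp (- (?k * al * real m)))"
    using q a0 by (subst (asm) ennreal_le_iff) auto
  also have "\<dots> = 2 * (real m * a) + 2 / q * exp (- (?k * al * real m))"
    using q by (simp add: field_simps)
  also have "\<dots> \<le> 2 * (real m * a) + 2 / c * exp (- (?k * al * real m))"
    using q c by (intro add_left_mono mult_right_mono divide_left_mono) auto
  finally show ?thesis .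
qed

end

section \<open>Assembling the private learner\<close>

lemma learnable_of_weak_learner:
  fixes H :: "('x :: countable \<Rightarrow> bool) set"
  assumes Q: "weak_learner H Q (1 / 2 - g) c" and c: "0 < c" and g: "0 < g" "g \<le> 1 / 2"
  shows "pure_dp_pac_learnable H"
proof -
  obtain th where th: "0 < th" "th < 1" and boost: "\<And>t. \<exists>Q. weak_learner H Q (th ^ t) (c ^ t)"
    using boosting[OF assms] by metis
  obtain R where R: "\<And>t. weak_learner H (R t) (th ^ t) (c ^ t)" using boost by metis
  have R_prob: "prob_space (R t)" and R_sets: "sets (R t) = sets hyp_space" for t
    using R[of t] by (auto simp: weak_learner_def)
  \<comment> \<open>The fourth root grows fast enough for \<open>m * th ^ t m\<close> to vanish, and
    slowly enough for \<open>exp (- k * sqrt m)\<close> to beat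
    \<open>(1 / c) ^ t m\<close>.\<close>
  define t where "t m = nat \<lfloor>sqrt (sqrt (real m))\<rfloor>" for m
  have t: "real (t m) \<le> sqrt (sqrt m)" "sqrt (sqrt m) - 1 \<le> real (t m)" for m
    unfolding t_def by (auto simp: of_nat_nat)
  \<comment> \<open>The prior depends on the dataset only through its length, which neighbours
    share, so privacy reduces to a single Gibbs mechanism.\<close>
  define A where "A S = gibbs (R (t (length S))) S" for S
  define al where "al m = 1 / sqrt (real m)" for m
  define k :: real where "k = 1 - exp (- 1)"
  have k: "0 < k" by (simp add: k_def)
  \<comment> \<open>The last summand only makes the bound on the failure probability strict.\<close>
  define be where "be m = 2 * (real m * th ^ t m) + 2 / c ^ t m * exp (- (k * al m * real m)) + 1 / real (Suc m)" for m
  have fail: "failure_prob A D m (al m) < be m" if D: "realizable_dist H D" for D m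
  proof -
    have "failure_prob A D m (al m) = failure_prob (gibbs (R (t m))) D m (al m)"
      unfolding failure_prob_def A_def
      by (intro integral_cong_AE) (auto simp: AE_measure_pmf_iff set_replicate_pmf)
    also have "\<dots> \<le> 2 * (real m * th ^ t m) + 2 / c ^ t m * exp (- (k * al m * real m))"
      unfolding k_def using R[of "t m"] D c
      by (intro gibbs_failure R_prob R_sets) (auto simp: weak_learner_def al_def)
    also have "\<dots> < be m" by (simp add: be_def)
    finally show ?thesis .
  qed
  have dp: "differentially_private 2 0 A"
    unfolding differentially_private_def
  proof (intro allI impI ballI)
    fix S S' :: "'x dataset" and E :: "('x \<Rightarrow> bool) set" assume nb: "neighbouring S S'" and E: "E \<in> sets hyp_space"
    then have "length S' = length S" by (simp add: neighbouring_def)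
    then show "measure (A S) E \<le> exp 2 * measure (A S') E + 0"
      using gibbs_private[OF R_prob R_sets nb E] by (simp add: A_def)
  qed
  have rand: "randomized_alg A"
    unfolding randomized_alg_def A_def using prob_space_gibbs[OF R_prob R_sets] sets_gibbs[OF R_prob R_sets] by simp
  have al_lim: "al \<longlonglongrightarrow> 0" unfolding al_def by real_asymp
  define l where "l = ln (1 / th)"
  define d where "d = ln (1 / c)"
  have l: "0 < l" using th by (simp add: l_def)
  have lim1: "(\<lambda>m. real m * th ^ t m) \<longlonglongrightarrow> 0"
  proof (rule tendsto_sandwich[OF _ _ tendsto_const])
    show "(\<lambda>m. exp (ln (real m) - l * (sqrt (sqrt (real m)) - 1))) \<longlonglongrightarrow> 0"
      using l by real_asymp
    show "\<forall>\<^sub>F m in sequentially. real m * th ^ t m \<le> exp (ln (real m) - l * (sqrt (sqrt (real m)) - 1))"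
      using eventually_gt_at_top[of 0]
    proof eventually_elim
      case (elim m)
      have "exp (l * real (t m)) = (1 / th) ^ t m"
        using th by (simp add: l_def exp_of_nat2_mult)
      then have "real m * th ^ t m = exp (ln (real m) - l * real (t m))"
        using elim by (simp add: exp_diff power_one_over)
      also have "\<dots> \<le> exp (ln (real m) - l * (sqrt (sqrt (real m)) - 1))"
        using l t(2)[of m] by simp
      finally show ?case .
    qed
  qed (use th in auto)
  have lim2: "(\<lambda>m. 2 / c ^ t m * exp (- (k * al m * real m))) \<longlonglongrightarrow> 0"
  proof (rule tendsto_sandwich[OF _ _ tendsto_const])
    show "(\<lambda>m. 2 * exp (\<bar>d\<bar> * sqrt (sqrt (real m)) - k * sqrt (real m))) \<longlonglongrightarrow> 0"
      using k by real_asymp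
    show "\<forall>\<^sub>F m in sequentially. 2 / c ^ t m * exp (- (k * al m * real m)) \<le> 2 * exp (\<bar>d\<bar> * sqrt (sqrt (real m)) - k * sqrt (real m))"
    proof (rule always_eventually, rule allI)
      fix m
      have "1 / c ^ t m = exp (d * real (t m))"
        using c by (simp add: d_def exp_of_nat2_mult power_one_over)
      also have "\<dots> \<le> exp (\<bar>d\<bar> * sqrt (sqrt (real m)))"
      proof -
        have "d * real (t m) \<le> \<bar>d\<bar> * real (t m)" by (intro mult_right_mono) auto
        also have "\<dots> \<le> \<bar>d\<bar> * sqrt (sqrt (real m))" using t(1)[of m] by (intro mult_left_mono) auto
        finally show ?thesis by simp
      qed
      finally have "1 / c ^ t m * exp (- (k * al m * real m)) \<le> exp (\<bar>d\<bar> * sqrt (sqrt (real m))) * exp (- (k * al m * real m))"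
        by (intro mult_right_mono) auto
      also have "\<dots> = exp (\<bar>d\<bar> * sqrt (sqrt (real m)) - k * sqrt (real m))"
      proof -
        have "al m * real m = sqrt (real m)" by (simp add: al_def real_div_sqrt)
        then show ?thesis by (simp add: mult.assoc flip: exp_add)
      qed
      finally show "2 / c ^ t m * exp (- (k * al m * real m)) \<le> 2 * exp (\<bar>d\<bar> * sqrt (sqrt (real m)) - k * sqrt (real m))"
        by simp
    qed
  qed (use c in auto)
  have "be \<longlonglongrightarrow> 2 * 0 + 0 + 0"
    unfolding be_def
    by (intro tendsto_add tendsto_mult tendsto_const lim1 lim2) real_asymp
  then show ?thesis
    unfolding pure_dp_pac_learnable_def pac_learner_def using al_lim rand dp fail
    by (intro exI[of _ al] exI[of _ be] exI[of _ A] exI[of _ 2] conjI allI impI) simp_all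
qed

theorem mainTheorem4:
  fixes H :: "('x :: countable \<Rightarrow> bool) set"
  shows "pure_dp_pac_learnable H \<longleftrightarrow> frac_clique_dim H \<noteq> \<infinity>"
proof
  assume "frac_clique_dim H \<noteq> \<infinity>"
  \<comment> \<open>A single such \<open>n\<close> suffices here, whereas the converse direction
    yields the inequality for all large \<open>n\<close>.\<close>
  then obtain n where "omega_star H n < 2 ^ n"
    by (auto simp only: frac_clique_dim_finite_iff eventually_sequentially)
  then obtain Q g c where "0 < g" "g \<le> 1 / 2" "0 < c" "weak_learner H Q (1 / 2 - g) c"
    by (rule weak_learner_of_omega_star_less)
  then show "pure_dp_pac_learnable H" by (intro learnable_of_weak_learner)
qed (rule frac_clique_dim_finite_of_learnable)

end
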